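(* Let $m\ge 1$ and $q_1,\dots,q_m\in k^*$. The twisted group algebra $k_{F_{\rm GCA}}[\mathbb{Z}_n^m]$ and the generalized Clifford algebra $C^{(n)}(q_1,\dots,q_m)$ are isomorphic as associative $k$-algebras. Consequently, $C^{(n)}(q_1,\dots,q_m)$ is an algebra in the symmetric Gr-category $(\mathrm{Vec}_{\mathbb{Z}_n^m},\mathcal{R}_{\rm GCA})$.
   Context: Standing assumptions: $n\ge 2$ is an integer, $k$ is a field with $\operatorname{char}k\nmid n$, and $\omega\in k$ is a primitive $n$-th root of unity; $k^*=k\setminus\{0\}$. Generalized Clifford algebra: $C^{(n)}(q_1,\dots,q_m)$ is the associative unital $k$-algebra generated by $e_1,\dots,e_m$ subject to $e_i^n=q_i1$ for all $i$ and $e_ie_j=\omega e_je_i$ for all $i>j$. Notation: $\mathbb{Z}_n^m$ is the direct product of $m$ copies of the cyclic group $\mathbb{Z}_n$, written additively; elements are $g=(g_1,\dots,g_m)$, each $g_i$ identified with its representative in $\{0,\dots,n-1\}$; $[a]$ is the integer part of a rational number $a$. Define $F_{\rm GCA}:\mathbb{Z}_n^m\times\mathbb{Z}_n^m\to k^*$ by $$F_{\rm GCA}(g,h)=\omega^{\sum_{1\le j<i\le m}g_ih_j}\prod_{i=1}^m q_i^{[\frac{g_i+h_i}{n}]},$$ and $$\mathcal{R}_{\rm GCA}(g,h)=\frac{F_{\rm GCA}(g,h)}{F_{\rm GCA}(h,g)}=\omega^{\sum_{1\le j<i\le m}(g_ih_j-g_jh_i)}.$$ Twisted group algebra: $k_{F_{\rm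 GCA}}[\mathbb{Z}_n^m]$ is the $k$-vector space with basis $\{u_g: g\in\mathbb{Z}_n^m\}$ and product $u_g\star u_h=F_{\rm GCA}(g,h)u_{g+h}$. Gr-category: $\mathrm{Vec}_{\mathbb{Z}_n^m}$ is the category of finite-dimensional $\mathbb{Z}_n^m$-graded $k$-spaces with degree-preserving linear maps, usual graded tensor product and trivial associativity constraint; $(\mathrm{Vec}_{\mathbb{Z}_n^m},\mathcal{R}_{\rm GCA})$ is this tensor category with the symmetric braiding $u\otimes v\mapsto\mathcal{R}_{\rm GCA}(|u|,|v|)\,v\otimes u$ on homogeneous elements ($|u|$ denotes the degree). An algebra in it is a finite-dimensional associative unital $k$-algebra $A=\bigoplus_g A_g$ with $A_gA_h\subseteq A_{g+h}$. *)

theory Defs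
  imports
    "HOL-Algebra.QuotRing"
    "HOL-Algebra.Product_Groups"
    "Jordan_Normal_Form.VS_Connect"
begin

text \<open>
  The ground field is the type \<open>'k :: field\<close>; \<^term>\<open>class_ring\<close> is that type as a ring record.
  HOL-Algebra's locale \<open>algebra\<close> is restricted to commutative algebras, hence the following one.
\<close>

locale assoc_algebra = vectorspace K A + A: ring A for K and A (structure) +
  assumes smult_mult_left:
      "\<lbrakk>c \<in> carrier K; x \<in> carrier A; y \<in> carrier A\<rbrakk> \<Longrightarrow> (c \<odot> x) \<otimes> y = c \<odot> (x \<otimes> y)"
    and smult_mult_right:
      "\<lbrakk>c \<in> carrier K; x \<in> carrier A; y \<in> carrier A\<rbrakk> \<Longrightarrow> x \<otimes> (c \<odot> y) = c \<odot> (x \<otimes> y)"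

definition algebra_iso ::
    "('k::field, 'a) module \<Rightarrow> ('k, 'b) module \<Rightarrow> ('a \<Rightarrow> 'b) \<Rightarrow> bool"
  where "algebra_iso A B \<phi> \<longleftrightarrow>
     assoc_algebra class_ring A \<and> assoc_algebra class_ring B \<and>
     \<phi> \<in> ring_iso A B \<and> (\<forall>c. \<forall>x\<in>carrier A. \<phi> (c \<odot>\<^bsub>A\<^esub> x) = c \<odot>\<^bsub>B\<^esub> \<phi> x)"


subsection \<open>Twisted monoid algebras\<close>

definition basis_elt :: "'g \<Rightarrow> 'g \<Rightarrow> 'k::field"
  where "basis_elt g = (\<lambda>x. if x = g then 1 else 0)"

text \<open>
  The vector space with basis \<open>M\<close>, realised as the finitely supported functions on the carrier
  of \<open>M\<close> (extended by 0), with the bilinear product \<open>u\<^sub>g \<star> u\<^sub>h = F(g,h) u\<^sub>g\<^sub>h\<close>. The vector \<open>u\<^sub>1\<close>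
  is a unit only if \<open>F(1,g) = F(g,1) = 1\<close>.
\<close>

definition twisted_monoid_algebra ::
    "('g, 'm) monoid_scheme \<Rightarrow> ('g \<Rightarrow> 'g \<Rightarrow> 'k::field) \<Rightarrow> ('k, 'g \<Rightarrow> 'k) module"
  where "twisted_monoid_algebra M F =
    \<lparr> carrier = {f. finite {g. f g \<noteq> 0} \<and> {g. f g \<noteq> 0} \<subseteq> carrier M},
      mult = (\<lambda>a b x. \<Sum>(g, h)\<in>{(g, h). a g \<noteq> 0 \<and> b h \<noteq> 0 \<and> g \<otimes>\<^bsub>M\<^esub> h = x}. F g h * a g * b h),
      one = basis_elt \<one>\<^bsub>M\<^esub>,
      zero = (\<lambda>_. 0),
      add = (\<lambda>a b x. a x + b x),
      smult = (\<lambda>c a x. c * a x) \<rparr>"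

lemma basis_elt_mult:
  fixes M :: "('g, 'm) monoid_scheme" and F :: "'g \<Rightarrow> 'g \<Rightarrow> 'k::field"
  defines "A \<equiv> twisted_monoid_algebra M F"
  shows "basis_elt g \<otimes>\<^bsub>A\<^esub> basis_elt h = F g h \<odot>\<^bsub>A\<^esub> basis_elt (g \<otimes>\<^bsub>M\<^esub> h)"
proof
  fix x
  have "{(a, b). (basis_elt g a :: 'k) \<noteq> 0 \<and> (basis_elt h b :: 'k) \<noteq> 0 \<and> a \<otimes>\<^bsub>M\<^esub> b = x} =
      (if x = g \<otimes>\<^bsub>M\<^esub> h then {(g, h)} else {})"
    by (auto simp: basis_elt_def)
  then show "(basis_elt g \<otimes>\<^bsub>A\<^esub> basis_elt h) x = (F g h \<odot>\<^bsub>A\<^esub> basis_elt (g \<otimes>\<^bsub>M\<^esub> h)) x"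
    by (simp add: A_def twisted_monoid_algebra_def basis_elt_def)
qed

text \<open>The free associative algebra is the monoid algebra of the free monoid (words in \<open>X\<close>).\<close>

definition free_algebra :: "'x set \<Rightarrow> ('k::field, 'x list \<Rightarrow> 'k) module"
  where "free_algebra X =
    twisted_monoid_algebra \<lparr>carrier = lists X, monoid.mult = (@), one = []\<rparr> (\<lambda>_ _. 1)"


subsection \<open>Generalized Clifford algebras\<close>

definition quotient_algebra :: "('k::field, 'a) module \<Rightarrow> 'a set \<Rightarrow> ('k, 'a set) module"
  where "quotient_algebra A I =
    \<lparr> carrier = carrier (A Quot I),
      mult = mult (A Quot I),
      one = one (A Quot I),
      zero = zero (A Quot I),
      add = add (A Quot I),
      smult = (\<lambda>c X. \<Union>x\<in>X. I +>\<^bsub>A\<^esub> (c \<odot>\<^bsub>A\<^esub> x)) \<rparr>"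

definition clifford_relations :: "nat \<Rightarrow> nat \<Rightarrow> 'k::field \<Rightarrow> (nat \<Rightarrow> 'k) \<Rightarrow> (nat list \<Rightarrow> 'k) set"
  where "clifford_relations n m \<omega> q =
    (let A = free_algebra {1..m}; e = (\<lambda>i. basis_elt [i]) in
      {e i [^]\<^bsub>A\<^esub> n \<ominus>\<^bsub>A\<^esub> q i \<odot>\<^bsub>A\<^esub> \<one>\<^bsub>A\<^esub> | i. i \<in> {1..m}} \<union>
      {e i \<otimes>\<^bsub>A\<^esub> e j \<ominus>\<^bsub>A\<^esub> \<omega> \<odot>\<^bsub>A\<^esub> (e j \<otimes>\<^bsub>A\<^esub> e i) | i j. i \<in> {1..m} \<and> j \<in> {1..m} \<and> i > j})"

definition gen_clifford_algebra ::
    "nat \<Rightarrow> nat \<Rightarrow> 'k::field \<Rightarrow> (nat \<Rightarrow> 'k) \<Rightarrow> ('k, (nat list \<Rightarrow> 'k) set) module"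
  where "gen_clifford_algebra n m \<omega> q =
    quotient_algebra (free_algebra {1..m})
      (genideal (free_algebra {1..m}) (clifford_relations n m \<omega> q))"


subsection \<open>The functions \<open>F\<close> and \<open>R\<close> on \<open>\<int>\<^sub>n\<^sup>m\<close>\<close>

definition primitive_root_of_unity :: "nat \<Rightarrow> 'k::field \<Rightarrow> bool"
  where "primitive_root_of_unity n \<omega> \<longleftrightarrow>
    n > 0 \<and> \<omega> ^ n = 1 \<and> (\<forall>j. 0 < j \<and> j < n \<longrightarrow> \<omega> ^ j \<noteq> 1)"

text \<open>
  Elements are the functions \<open>g\<close> on \<open>{1..m}\<close> with integer values in \<open>{0..n-1}\<close>; the group
  operation, written multiplicatively in HOL-Algebra, is componentwise addition modulo \<open>n\<close>.
\<close>

definition Zn_power :: "nat \<Rightarrow> nat \<Rightarrow> (nat \<Rightarrow> int) monoid"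
  where "Zn_power n m = product_group {1..m} (\<lambda>_. integer_mod_group n)"

definition F_GCA ::
    "nat \<Rightarrow> nat \<Rightarrow> 'k::field \<Rightarrow> (nat \<Rightarrow> 'k) \<Rightarrow> (nat \<Rightarrow> int) \<Rightarrow> (nat \<Rightarrow> int) \<Rightarrow> 'k"
  where "F_GCA n m \<omega> q g h =
    \<omega> powi (\<Sum>i = 1..m. \<Sum>j = 1..<i. g i * h j) * (\<Prod>i = 1..m. q i powi ((g i + h i) div int n))"

definition R_GCA ::
    "nat \<Rightarrow> nat \<Rightarrow> 'k::field \<Rightarrow> (nat \<Rightarrow> 'k) \<Rightarrow> (nat \<Rightarrow> int) \<Rightarrow> (nat \<Rightarrow> int) \<Rightarrow> 'k"
  where "R_GCA n m \<omega> q g h = F_GCA n m \<omega> q g h / F_GCA n m \<omega> q h g"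


subsection \<open>Algebras in symmetric Gr-categories\<close>

text \<open>
  \<open>u \<otimes> v \<mapsto> R(|u|,|v|) v \<otimes> u\<close> is a symmetric braiding on the category of \<open>G\<close>-graded spaces with
  trivial associativity: \<open>R_nonzero\<close> is invertibility, \<open>R_mult_left\<close> and \<open>R_mult_right\<close> are the
  two hexagon axioms evaluated on homogeneous elements (where \<open>|u \<otimes> v| = |u||v|\<close>), and
  \<open>R_symmetric\<close> says that the braiding is its own inverse.
\<close>

locale symmetric_Gr_category = comm_group G for G (structure) +
  fixes R :: "'g \<Rightarrow> 'g \<Rightarrow> 'k::field"
  assumes finite_group: "finite (carrier G)"
    and R_nonzero: "\<lbrakk>g \<in> carrier G; h \<in> carrier G\<rbrakk> \<Longrightarrow> R g h \<noteq> 0"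
    and R_mult_left:
      "\<lbrakk>g \<in> carrier G; h \<in> carrier G; l \<in> carrier G\<rbrakk> \<Longrightarrow> R (g \<otimes> h) l = R g l * R h l"
    and R_mult_right:
      "\<lbrakk>g \<in> carrier G; h \<in> carrier G; l \<in> carrier G\<rbrakk> \<Longrightarrow> R g (h \<otimes> l) = R g h * R g l"
    and R_symmetric: "\<lbrakk>g \<in> carrier G; h \<in> carrier G\<rbrakk> \<Longrightarrow> R g h * R h g = 1"

text \<open>\<open>\<Gamma> g\<close> is the homogeneous component of degree \<open>g\<close> of the algebra \<open>A\<close>.\<close>

definition algebra_in_symmetric_Gr_category ::
    "'g monoid \<Rightarrow> ('g \<Rightarrow> 'g \<Rightarrow> 'k::field) \<Rightarrow> ('k, 'a) module \<Rightarrow> ('g \<Rightarrow> 'a set) \<Rightarrow> bool"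
  where "algebra_in_symmetric_Gr_category G R A \<Gamma> \<longleftrightarrow>
    symmetric_Gr_category G R \<and>
    assoc_algebra class_ring A \<and> vectorspace.fin_dim class_ring A \<and>
    (\<forall>g\<in>carrier G. subspace class_ring (\<Gamma> g) A) \<and>
    (\<forall>a\<in>carrier A. \<exists>!c. c \<in> (\<Pi>\<^sub>E g\<in>carrier G. \<Gamma> g) \<and> a = (\<Oplus>\<^bsub>A\<^esub>g\<in>carrier G. c g)) \<and>
    (\<forall>g\<in>carrier G. \<forall>h\<in>carrier G. \<forall>x\<in>\<Gamma> g. \<forall>y\<in>\<Gamma> h. x \<otimes>\<^bsub>A\<^esub> y \<in> \<Gamma> (g \<otimes>\<^bsub>G\<^esub> h))"

end

theory Submission
  imports Defs
begin

text \<open>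
  Sending the generator \<open>e\<^sub>i\<close> to the basis element of the \<open>i\<close>-th unit vector defines a homomorphism
  \<open>\<pi>\<close> from the free algebra to the twisted group algebra; it maps a word \<open>w\<close> to a scalar multiple of
  the basis element of degree \<open>deg w\<close>, and it kills the Clifford relations. Modulo these relations
  every word \<open>w\<close> can be rewritten to a multiple of the sorted word \<open>e\<^sub>1\<^sup>a e\<^sub>2\<^sup>b \<dots>\<close> whose exponents
  are the entries of \<open>deg w\<close>; as \<open>\<pi>\<close> maps the sorted words to the basis, the scalar is forced and
  the kernel of \<open>\<pi>\<close> is the ideal of the relations. The grading of the Clifford algebra is
  transported from the lines spanned by the basis elements.
\<close>

text \<open>No linear independence or confluence is verified inside the quotient. It is enough that
  every word reduces to an explicit multiple of one normal word: the linear section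
  \<open>\<sigma>\<close> of \<open>\<pi>\<close> then satisfies
  \<open>\<pi> (\<sigma> f) = f\<close>, and \<open>a - \<sigma> (\<pi> a)\<close> lies in the ideal
  of relations for every \<open>a\<close>. These two facts give injectivity, surjectivity and
  multiplicativity of the isomorphism. The scalar is tracked letter by letter. The exponent of
  \<open>\<omega>\<close> in \<open>F\<close> collects the products of a coordinate with those of
  smaller index, and the exponents of the \<open>q i\<close> are the carries of addition modulo
  \<open>n\<close>. Hence the value of \<open>F\<close> at a unit vector and \<open>g\<close> is
  exactly what it costs to insert one more generator in front of the sorted word of degree
  \<open>g\<close>: one \<open>\<omega>\<close> for each smaller letter crossed, and one
  \<open>q i\<close> when the \<open>n\<close>-th copy of \<open>i\<close> arrives. Both factors are
  cocycles, the first as a bicharacter, the second by associativity of addition with carry. The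
  carry factor is symmetric, so it cancels in the braiding and leaves a quotient of
  bicharacters.\<close>

section \<open>Twisted monoid algebras\<close>

text \<open>
  The value at \<open>a\<close> of the linear extension of \<open>\<phi>\<close>. Evaluating products through such functionals
  turns associativity and multiplicativity into identities between values on basis elements.
\<close>

definition pairing :: "('g \<Rightarrow> 'k::field) \<Rightarrow> ('g \<Rightarrow> 'k) \<Rightarrow> 'k"
  where "pairing \<phi> a = (\<Sum>g | a g \<noteq> 0. \<phi> g * a g)"

lemma pairing_superset:
  assumes "finite S" and "{g. a g \<noteq> 0} \<subseteq> S"
  shows "pairing \<phi> a = (\<Sum>g\<in>S. \<phi> g * a g)"
  unfolding pairing_def using assms by (intro sum.mono_neutral_left) auto

lemma pairing_cong:
  "(\<And>g. a g \<noteq> 0 \<Longrightarrow> \<phi> g = \<psi> g) \<Longrightarrow> pairing \<phi> a = pairing \<psi> a"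
  unfolding pairing_def by (intro sum.cong) auto

lemma pairing_add:
  assumes "finite {g. a g \<noteq> 0}" and "finite {g. b g \<noteq> 0}"
  shows "pairing \<phi> (\<lambda>g. a g + b g) = pairing \<phi> a + pairing \<phi> b"
proof -
  let ?S = "{g. a g \<noteq> 0} \<union> {g. b g \<noteq> 0}"
  have S: "finite ?S" using assms by simp
  have "pairing \<phi> (\<lambda>g. a g + b g) = (\<Sum>g\<in>?S. \<phi> g * (a g + b g))"
    by (rule pairing_superset[OF S]) auto
  also have "\<dots> = (\<Sum>g\<in>?S. \<phi> g * a g) + (\<Sum>g\<in>?S. \<phi> g * b g)"
    by (simp add: distrib_left sum.distrib)
  also have "\<dots> = pairing \<phi> a + pairing \<phi> b"
    by (simp add: pairing_superset[OF S])
  finally show ?thesis .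
qed

lemma pairing_cmult: "pairing \<phi> (\<lambda>g. c * a g) = c * pairing \<phi> a"
  by (cases "c = 0") (simp_all add: pairing_def sum_distrib_left mult.left_commute)

lemma pairing_add_left:
  "pairing (\<lambda>g. \<phi> g + \<psi> g) a = pairing \<phi> a + pairing \<psi> a"
  by (simp add: pairing_def distrib_right sum.distrib)

lemma pairing_cmult_left: "pairing (\<lambda>g. c * \<phi> g) a = c * pairing \<phi> a"
  by (simp add: pairing_def sum_distrib_left mult.assoc)

lemma pairing_zero [simp]: "pairing \<phi> (\<lambda>_. 0) = 0"
  by (simp add: pairing_def)

lemma finite_support_basis_elt [simp]: "finite {x. basis_elt g x \<noteq> (0 :: 'k::field)}"
  by (simp add: basis_elt_def)

lemma pairing_basis_elt [simp]: "pairing \<phi> (basis_elt g) = \<phi> g"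
  by (subst pairing_superset[of "{g}"]) (auto simp: basis_elt_def)

text \<open>Coordinates are themselves functionals, so an equation between functions can be proved
  pointwise as an identity between pairings.\<close>

lemma pairing_point:
  assumes "finite {g. a g \<noteq> 0}"
  shows "pairing (basis_elt x) a = a x"
proof -
  have "pairing (basis_elt x) a = (\<Sum>g\<in>insert x {g. a g \<noteq> 0}. basis_elt x g * a g)"
    using assms by (intro pairing_superset) auto
  also have "\<dots> = (\<Sum>g\<in>{x}. basis_elt x g * a g)"
    using assms by (intro sum.mono_neutral_right) (auto simp: basis_elt_def)
  finally show ?thesis by (simp add: basis_elt_def)
qed

text \<open>The product is left out on purpose: it is handled through
  \<open>pairing_twisted_mult\<close> and \<open>basis_elt_mult\<close> rather than as a raw sum
  over pairs.\<close>

lemma twisted_monoid_algebra_simps [simp]: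
  "carrier (twisted_monoid_algebra M F) = {f. finite {g. f g \<noteq> 0} \<and> {g. f g \<noteq> 0} \<subseteq> carrier M}"
  "\<one>\<^bsub>twisted_monoid_algebra M F\<^esub> = basis_elt \<one>\<^bsub>M\<^esub>"
  "\<zero>\<^bsub>twisted_monoid_algebra M F\<^esub> = (\<lambda>_. 0)"
  "a \<oplus>\<^bsub>twisted_monoid_algebra M F\<^esub> b = (\<lambda>x. a x + b x)"
  "c \<odot>\<^bsub>twisted_monoid_algebra M F\<^esub> a = (\<lambda>x. c * a x)"
  by (simp_all add: twisted_monoid_algebra_def)

context
  fixes M :: "('g, 'm) monoid_scheme" and F :: "'g \<Rightarrow> 'g \<Rightarrow> 'k::field" and a b :: "'g \<Rightarrow> 'k"
  assumes fin: "finite {g. a g \<noteq> 0}" "finite {h. b h \<noteq> 0}"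
begin

private abbreviation "supports \<equiv> {g. a g \<noteq> 0} \<times> {h. b h \<noteq> 0}"

text \<open>The index set becomes a fibre of the product map on \<open>supports\<close>, the shape
  in which \<open>sum.group\<close> can merge the sums over all fibres.\<close>

private lemma mult_eq:
  "(a \<otimes>\<^bsub>twisted_monoid_algebra M F\<^esub> b) x =
    (\<Sum>p | p \<in> supports \<and> fst p \<otimes>\<^bsub>M\<^esub> snd p = x. F (fst p) (snd p) * a (fst p) * b (snd p))"
proof -
  have "{(g, h). a g \<noteq> 0 \<and> b h \<noteq> 0 \<and> g \<otimes>\<^bsub>M\<^esub> h = x} =
      {p. p \<in> supports \<and> fst p \<otimes>\<^bsub>M\<^esub> snd p = x}"
    by (rule Set.set_eqI) (simp only: mem_Collect_eq mem_Times_iff case_prod_beta conj_assoc)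
  then have "(a \<otimes>\<^bsub>twisted_monoid_algebra M F\<^esub> b) x =
      (\<Sum>(g, h)\<in>{p. p \<in> supports \<and> fst p \<otimes>\<^bsub>M\<^esub> snd p = x}. F g h * a g * b h)"
    by (simp only: twisted_monoid_algebra_def monoid.simps)
  also have "\<dots> = (\<Sum>p | p \<in> supports \<and> fst p \<otimes>\<^bsub>M\<^esub> snd p = x.
      F (fst p) (snd p) * a (fst p) * b (snd p))"
    by (simp only: split_def)
  finally show ?thesis .
qed

lemma twisted_mult_support:
  "{x. (a \<otimes>\<^bsub>twisted_monoid_algebra M F\<^esub> b) x \<noteq> 0} \<subseteq>
    (\<lambda>p. fst p \<otimes>\<^bsub>M\<^esub> snd p) ` ({g. a g \<noteq> 0} \<times> {h. b h \<noteq> 0})"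
proof (rule subsetI)
  fix x assume "x \<in> {x. (a \<otimes>\<^bsub>twisted_monoid_algebra M F\<^esub> b) x \<noteq> 0}"
  then obtain p where "p \<in> supports" and "fst p \<otimes>\<^bsub>M\<^esub> snd p = x"
    unfolding mem_Collect_eq mult_eq by (blast elim: sum.not_neutral_contains_not_neutral)
  then show "x \<in> (\<lambda>p. fst p \<otimes>\<^bsub>M\<^esub> snd p) ` supports" by blast
qed

lemma finite_support_twisted_mult:
  "finite {x. (a \<otimes>\<^bsub>twisted_monoid_algebra M F\<^esub> b) x \<noteq> 0}"
  by (rule finite_subset[OF twisted_mult_support]) (simp add: fin)

text \<open>Grouping pairs of basis vectors by their product turns the sum over fibres into a double
  sum over the two supports, so a functional of a product becomes a nested pairing that carries the
  weight \<open>F g h\<close>.\<close>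

lemma pairing_twisted_mult:
  "pairing \<phi> (a \<otimes>\<^bsub>twisted_monoid_algebra M F\<^esub> b) =
    pairing (\<lambda>g. pairing (\<lambda>h. \<phi> (g \<otimes>\<^bsub>M\<^esub> h) * F g h) b) a"
proof -
  define pr where "pr = (\<lambda>p. fst p \<otimes>\<^bsub>M\<^esub> snd p)"
  let ?t = "\<lambda>p. \<phi> (pr p) * F (fst p) (snd p) * a (fst p) * b (snd p)"
  have "pairing \<phi> (a \<otimes>\<^bsub>twisted_monoid_algebra M F\<^esub> b) =
      (\<Sum>x\<in>pr ` supports. \<phi> x * (a \<otimes>\<^bsub>twisted_monoid_algebra M F\<^esub> b) x)"
    by (rule pairing_superset) (use fin twisted_mult_support in \<open>simp_all add: pr_def\<close>)
  also have "\<dots> = (\<Sum>x\<in>pr ` supports. \<Sum>p | p \<in> supports \<and> pr p = x. ?t p)"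
    by (auto simp: mult_eq pr_def sum_distrib_left mult.assoc intro!: sum.cong)
  also have "\<dots> = (\<Sum>p\<in>supports. ?t p)"
    using fin by (intro sum.group) auto
  also have "\<dots> = (\<Sum>g | a g \<noteq> 0. \<Sum>h | b h \<noteq> 0. ?t (g, h))"
    by (simp add: sum.cartesian_product case_prod_beta)
  also have "\<dots> = pairing (\<lambda>g. pairing (\<lambda>h. \<phi> (g \<otimes>\<^bsub>M\<^esub> h) * F g h) b) a"
    by (simp add: pairing_def pr_def sum_distrib_right mult.assoc mult.commute[of "b _"])
  finally show ?thesis .
qed

lemma twisted_mult_apply:
  "(a \<otimes>\<^bsub>twisted_monoid_algebra M F\<^esub> b) x =
    pairing (\<lambda>g. pairing (\<lambda>h. basis_elt x (g \<otimes>\<^bsub>M\<^esub> h) * F g h) b) a"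
  using pairing_point[OF finite_support_twisted_mult] pairing_twisted_mult by metis

end

text \<open>A normalised 2-cocycle: the cocycle identity is associativity of the product on basis
  elements, and the normalisation makes the basis element at \<open>\<one>\<close> a unit. The
  constant 1 gives the free algebra, \<open>F_GCA\<close> the twisted group algebra.\<close>

locale twisting = monoid M for M :: "('g, 'm) monoid_scheme" (structure) +
  fixes F :: "'g \<Rightarrow> 'g \<Rightarrow> 'k::field"
  assumes twist_one_left: "g \<in> carrier M \<Longrightarrow> F \<one> g = 1"
    and twist_one_right: "g \<in> carrier M \<Longrightarrow> F g \<one> = 1"
    and twist_cocycle:
      "\<lbrakk>g \<in> carrier M; h \<in> carrier M; l \<in> carrier M\<rbrakk> \<Longrightarrow>
        F g h * F (g \<otimes> h) l = F h l * F g (h \<otimes> l)"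
begin

abbreviation "T \<equiv> twisted_monoid_algebra M F"

lemma twisted_algebra_mult_closed:
  assumes "a \<in> carrier T" and "b \<in> carrier T"
  shows "a \<otimes>\<^bsub>T\<^esub> b \<in> carrier T"
proof -
  have "(\<lambda>p. fst p \<otimes> snd p) ` ({g. a g \<noteq> 0} \<times> {h. b h \<noteq> 0}) \<subseteq> carrier M"
    using assms by (auto simp: subset_iff)
  moreover have "finite {g. a g \<noteq> 0}" "finite {h. b h \<noteq> 0}" using assms by auto
  ultimately show ?thesis
    using finite_support_twisted_mult[of a b M F] twisted_mult_support[of a b M F] by auto
qed

lemma twisted_algebra_add_closed:
  assumes "a \<in> carrier T" and "b \<in> carrier T"
  shows "a \<oplus>\<^bsub>T\<^esub> b \<in> carrier T"
proof -
  have "{g. a g + b g \<noteq> 0} \<subseteq> {g. a g \<noteq> 0} \<union> {g. b g \<noteq> 0}" by auto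
  with assms show ?thesis by (auto intro: finite_subset)
qed

lemma twisted_algebra_mult_assoc:
  assumes "a \<in> carrier T" and "b \<in> carrier T" and "c \<in> carrier T"
  shows "a \<otimes>\<^bsub>T\<^esub> b \<otimes>\<^bsub>T\<^esub> c = a \<otimes>\<^bsub>T\<^esub> (b \<otimes>\<^bsub>T\<^esub> c)"
proof
  fix x
  have fin: "finite {g. a g \<noteq> 0}" "finite {g. b g \<noteq> 0}" "finite {g. c g \<noteq> 0}"
    and supp: "{g. a g \<noteq> 0} \<subseteq> carrier M" "{g. b g \<noteq> 0} \<subseteq> carrier M" "{g. c g \<noteq> 0} \<subseteq> carrier M"
    using assms by auto
  note fin' = finite_support_twisted_mult[OF fin(1,2)] finite_support_twisted_mult[OF fin(2,3)]
  have "(a \<otimes>\<^bsub>T\<^esub> b \<otimes>\<^bsub>T\<^esub> c) x =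
      pairing (\<lambda>g. pairing (\<lambda>h. pairing (\<lambda>l. basis_elt x (g \<otimes> h \<otimes> l) * F (g \<otimes> h) l) c * F g h) b) a"
    by (simp only: twisted_mult_apply[OF fin'(1) fin(3)] pairing_twisted_mult[OF fin(1,2)])
  also have "\<dots> = pairing (\<lambda>g. pairing (\<lambda>h. pairing (\<lambda>l. basis_elt x (g \<otimes> h \<otimes> l) * (F g h * F (g \<otimes> h) l)) c) b) a"
    by (simp add: pairing_cmult_left[symmetric] ac_simps)
  \<comment> \<open>The two factors of the cocycle now stand side by side.
    \<open>pairing_cong\<close> compares the functionals only on the supports, hence only on
    elements of the monoid, where the cocycle identity is available.\<close>
  also have "\<dots> = pairing (\<lambda>g. pairing (\<lambda>h. pairing (\<lambda>l. basis_elt x (g \<otimes> (h \<otimes> l)) * F g (h \<otimes> l) * F h l) c) b) a"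
    using supp by (intro pairing_cong) (auto simp: subset_iff twist_cocycle m_assoc ac_simps)
  also have "\<dots> = (a \<otimes>\<^bsub>T\<^esub> (b \<otimes>\<^bsub>T\<^esub> c)) x"
    by (simp only: twisted_mult_apply[OF fin(1) fin'(2)] pairing_twisted_mult[OF fin(2,3)])
  finally show "(a \<otimes>\<^bsub>T\<^esub> b \<otimes>\<^bsub>T\<^esub> c) x = (a \<otimes>\<^bsub>T\<^esub> (b \<otimes>\<^bsub>T\<^esub> c)) x" .
qed

lemma basis_elt_closed: "g \<in> carrier M \<Longrightarrow> basis_elt g \<in> carrier T"
  by (auto simp: basis_elt_def)

lemma twisted_algebra_distrib:
  assumes "a \<in> carrier T" and "b \<in> carrier T" and "c \<in> carrier T"
  shows "(a \<oplus>\<^bsub>T\<^esub> b) \<otimes>\<^bsub>T\<^esub> c = (a \<otimes>\<^bsub>T\<^esub> c) \<oplus>\<^bsub>T\<^esub> (b \<otimes>\<^bsub>T\<^esub> c)"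
    and "c \<otimes>\<^bsub>T\<^esub> (a \<oplus>\<^bsub>T\<^esub> b) = (c \<otimes>\<^bsub>T\<^esub> a) \<oplus>\<^bsub>T\<^esub> (c \<otimes>\<^bsub>T\<^esub> b)"
proof -
  have fin: "finite {g. a g \<noteq> 0}" "finite {g. b g \<noteq> 0}" "finite {g. c g \<noteq> 0}"
    using assms by auto
  have fin': "finite {g. a g + b g \<noteq> 0}"
    using twisted_algebra_add_closed[OF assms(1,2)] by simp
  show "(a \<oplus>\<^bsub>T\<^esub> b) \<otimes>\<^bsub>T\<^esub> c = (a \<otimes>\<^bsub>T\<^esub> c) \<oplus>\<^bsub>T\<^esub> (b \<otimes>\<^bsub>T\<^esub> c)"
    and "c \<otimes>\<^bsub>T\<^esub> (a \<oplus>\<^bsub>T\<^esub> b) = (c \<otimes>\<^bsub>T\<^esub> a) \<oplus>\<^bsub>T\<^esub> (c \<otimes>\<^bsub>T\<^esub> b)"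
    using fin fin' by (auto simp: fun_eq_iff twisted_mult_apply pairing_add pairing_add_left)
qed

lemma abelian_group_twisted_algebra: "abelian_group T"
proof (rule abelian_groupI)
  show "\<exists>y\<in>carrier T. y \<oplus>\<^bsub>T\<^esub> a = \<zero>\<^bsub>T\<^esub>" if "a \<in> carrier T" for a
    using that by (intro bexI[of _ "\<lambda>x. - a x"]) simp_all
  show "a \<oplus>\<^bsub>T\<^esub> b \<in> carrier T" if "a \<in> carrier T" and "b \<in> carrier T" for a b
    using that by (rule twisted_algebra_add_closed)
qed (simp_all add: ac_simps)

lemma monoid_twisted_algebra: "Group.monoid T"
proof (rule monoidI)
  fix a assume a: "a \<in> carrier T"
  then have fin: "finite {g. a g \<noteq> 0}" and supp: "\<And>g. a g \<noteq> 0 \<Longrightarrow> g \<in> carrier M" by auto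
  have "pairing (\<lambda>h. basis_elt x (\<one> \<otimes> h) * F \<one> h) a = a x" for x
    unfolding pairing_point[OF fin, symmetric, of x]
    by (rule pairing_cong) (simp add: supp twist_one_left)
  then show "\<one>\<^bsub>T\<^esub> \<otimes>\<^bsub>T\<^esub> a = a"
    by (simp add: fun_eq_iff twisted_mult_apply fin)
  have "pairing (\<lambda>h. basis_elt x (h \<otimes> \<one>) * F h \<one>) a = a x" for x
    unfolding pairing_point[OF fin, symmetric, of x]
    by (rule pairing_cong) (simp add: supp twist_one_right)
  then show "a \<otimes>\<^bsub>T\<^esub> \<one>\<^bsub>T\<^esub> = a"
    by (simp add: fun_eq_iff twisted_mult_apply fin)
qed (simp_all only: twisted_algebra_mult_closed twisted_algebra_mult_assoc
    twisted_monoid_algebra_simps(2) basis_elt_closed one_closed)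

lemma ring_twisted_algebra: "ring T"
  using abelian_group_twisted_algebra monoid_twisted_algebra
  by (rule ringI) (fact twisted_algebra_distrib)+

lemma twisted_algebra_smult_closed:
  assumes "a \<in> carrier T"
  shows "c \<odot>\<^bsub>T\<^esub> a \<in> carrier T"
  using assms by (cases "c = 0") simp_all

lemma assoc_algebra_twisted_algebra: "assoc_algebra class_ring T"
proof -
  have "Module.module class_ring T"
    using class_cring.cring_axioms abelian_group_twisted_algebra
  proof (rule moduleI)
    show "c \<odot>\<^bsub>T\<^esub> a \<in> carrier T" if "a \<in> carrier T" for c a
      using that by (rule twisted_algebra_smult_closed)
  qed (simp_all add: distrib_left distrib_right mult.assoc)
  then have "vectorspace class_ring T"
    by (simp add: vectorspace_def class_field)
  moreover have "assoc_algebra_axioms class_ring T"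
  proof (standard, goal_cases)
    case (1 c x y)
    have fin: "finite {g. x g \<noteq> 0}" "finite {g. y g \<noteq> 0}" "finite {g. c * x g \<noteq> 0}"
      using 1 twisted_algebra_smult_closed[of x c] by simp_all
    then show ?case by (simp add: fun_eq_iff twisted_mult_apply pairing_cmult)
  next
    case (2 c x y)
    have fin: "finite {g. x g \<noteq> 0}" "finite {g. y g \<noteq> 0}" "finite {g. c * y g \<noteq> 0}"
      using 2 twisted_algebra_smult_closed[of y c] by simp_all
    then show ?case
      by (simp add: fun_eq_iff twisted_mult_apply pairing_cmult pairing_cmult_left)
  qed
  ultimately show ?thesis
    by (simp add: assoc_algebra_def ring_twisted_algebra)
qed

end

section \<open>Linear maps that send basis elements to multiples of basis elements\<close>

text \<open>The linear extension of \<open>w \<mapsto> s(w) u\<close>, where \<open>u\<close> is the basis element \<open>d(w)\<close>.\<close>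

definition push :: "('w \<Rightarrow> 'k) \<Rightarrow> ('w \<Rightarrow> 'g) \<Rightarrow> ('w \<Rightarrow> 'k::field) \<Rightarrow> 'g \<Rightarrow> 'k"
  where "push s d a = (\<lambda>g. pairing (\<lambda>w. s w * basis_elt g (d w)) a)"

lemma basis_elt_commute: "basis_elt g h = basis_elt h g"
  by (simp add: basis_elt_def eq_commute)

lemma push_basis_elt: "push s d (basis_elt w) = (\<lambda>g. s w * basis_elt (d w) g)"
  by (rule ext) (simp add: push_def basis_elt_commute[of _ "d w"])

lemma push_add:
  assumes "finite {w. a w \<noteq> 0}" and "finite {w. b w \<noteq> 0}"
  shows "push s d (\<lambda>w. a w + b w) = (\<lambda>g. push s d a g + push s d b g)"
  by (simp add: push_def pairing_add assms)

lemma push_cmult: "push s d (\<lambda>w. c * a w) = (\<lambda>g. c * push s d a g)"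
  by (simp add: push_def pairing_cmult)

lemma push_support: "{g. push s d a g \<noteq> 0} \<subseteq> d ` {w. a w \<noteq> 0}"
proof (rule subsetI)
  fix g assume "g \<in> {g. push s d a g \<noteq> 0}"
  then obtain w where "a w \<noteq> 0" and "s w * basis_elt g (d w) * a w \<noteq> 0"
    unfolding push_def pairing_def mem_Collect_eq
    by (blast elim: sum.not_neutral_contains_not_neutral)
  then show "g \<in> d ` {w. a w \<noteq> 0}"
    by (auto simp: basis_elt_def split: if_splits)
qed

lemma finite_support_push:
  "finite {w. a w \<noteq> 0} \<Longrightarrow> finite {g. push s d a g \<noteq> 0}"
  using push_support by (rule finite_subset) (rule finite_imageI)

text \<open>The transpose of \<open>push\<close>: functionals on the target pull back along
  \<open>d\<close> with weight \<open>s\<close>. Composites and products of pushes reduce to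
  computations with functionals in this way.\<close>

lemma pairing_push:
  assumes "finite {w. a w \<noteq> 0}"
  shows "pairing \<phi> (push s d a) = pairing (\<lambda>w. \<phi> (d w) * s w) a"
proof -
  let ?S = "{w. a w \<noteq> 0}"
  have "pairing \<phi> (push s d a) = (\<Sum>g\<in>d ` ?S. \<phi> g * push s d a g)"
    using finite_imageI[OF assms] push_support by (rule pairing_superset)
  also have "\<dots> = (\<Sum>g\<in>d ` ?S. \<Sum>w\<in>?S. if d w = g then \<phi> g * s w * a w else 0)"
    unfolding push_def pairing_def sum_distrib_left
    by (intro sum.cong refl) (simp add: basis_elt_def)
  also have "\<dots> = (\<Sum>w\<in>?S. \<Sum>g\<in>d ` ?S. if d w = g then \<phi> g * s w * a w else 0)"
    by (rule sum.swap)
  also have "\<dots> = (\<Sum>w\<in>?S. \<phi> (d w) * s w * a w)"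
    using assms by (intro sum.cong refl) (simp add: sum.delta)
  finally show ?thesis by (simp add: pairing_def)
qed

lemma push_push:
  assumes "finite {w. a w \<noteq> 0}"
  shows "push s' d' (push s d a) = push (\<lambda>w. s w * s' (d w)) (\<lambda>w. d' (d w)) a"
  unfolding push_def[of s'] pairing_push[OF assms] unfolding push_def by (simp add: ac_simps)

lemma push_identity:
  assumes "finite {g. a g \<noteq> 0}" and "\<And>g. a g \<noteq> 0 \<Longrightarrow> s g = 1 \<and> d g = g"
  shows "push s d a = a"
proof
  fix g
  have "push s d a g = pairing (basis_elt g) a"
    unfolding push_def by (rule pairing_cong) (simp add: assms(2))
  then show "push s d a g = a g"
    by (simp add: pairing_point assms(1))
qed

lemma push_closed:
  assumes "a \<in> carrier (twisted_monoid_algebra M F)" and "\<And>w. w \<in> carrier M \<Longrightarrow> d w \<in> carrier G"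
  shows "push s d a \<in> carrier (twisted_monoid_algebra G F')"
proof -
  have "d ` {w. a w \<noteq> 0} \<subseteq> carrier G" using assms by (auto simp: subset_iff)
  with push_support[of s d a] have "{g. push s d a g \<noteq> 0} \<subseteq> carrier G" by (rule subset_trans)
  then show ?thesis using assms(1) by (simp add: finite_support_push)
qed

text \<open>On basis elements both sides are multiples of the same vector, and the condition on
  \<open>s\<close> equates the coefficients. When \<open>s\<close> has no zeros, this condition says
  that \<open>F\<close> and the pullback of \<open>F'\<close> along \<open>d\<close> differ by the
  coboundary of \<open>s\<close>.\<close>

lemma push_mult:
  assumes a: "a \<in> carrier (twisted_monoid_algebra M F)"
    and b: "b \<in> carrier (twisted_monoid_algebra M F)"
    and d: "\<And>v w. v \<in> carrier M \<Longrightarrow> w \<in> carrier M \<Longrightarrow> d (v \<otimes>\<^bsub>M\<^esub> w) = d v \<otimes>\<^bsub>G\<^esub> d w"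
    and s: "\<And>v w. v \<in> carrier M \<Longrightarrow> w \<in> carrier M \<Longrightarrow> F v w * s (v \<otimes>\<^bsub>M\<^esub> w) = s v * s w * F' (d v) (d w)"
  shows "push s d (a \<otimes>\<^bsub>twisted_monoid_algebra M F\<^esub> b) =
    push s d a \<otimes>\<^bsub>twisted_monoid_algebra G F'\<^esub> push s d b"
proof
  fix x
  have fin: "finite {g. a g \<noteq> 0}" "finite {g. b g \<noteq> 0}"
    and supp: "\<And>g. a g \<noteq> 0 \<Longrightarrow> g \<in> carrier M" "\<And>g. b g \<noteq> 0 \<Longrightarrow> g \<in> carrier M"
    using a b by auto
  have "push s d (a \<otimes>\<^bsub>twisted_monoid_algebra M F\<^esub> b) x =
      pairing (\<lambda>v. pairing (\<lambda>w. s (v \<otimes>\<^bsub>M\<^esub> w) * basis_elt x (d (v \<otimes>\<^bsub>M\<^esub> w)) * F v w) b) a"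
    unfolding push_def by (rule pairing_twisted_mult[OF fin])
  also have "\<dots> = pairing (\<lambda>v. pairing (\<lambda>w. basis_elt x (d v \<otimes>\<^bsub>G\<^esub> d w) * F' (d v) (d w) * s w) b * s v) a"
  proof (rule pairing_cong)
    fix v assume v: "a v \<noteq> 0"
    have "pairing (\<lambda>w. s (v \<otimes>\<^bsub>M\<^esub> w) * basis_elt x (d (v \<otimes>\<^bsub>M\<^esub> w)) * F v w) b =
        pairing (\<lambda>w. s v * (basis_elt x (d v \<otimes>\<^bsub>G\<^esub> d w) * F' (d v) (d w) * s w)) b"
    proof (rule pairing_cong)
      fix w assume w: "b w \<noteq> 0"
      have "s (v \<otimes>\<^bsub>M\<^esub> w) * basis_elt x (d (v \<otimes>\<^bsub>M\<^esub> w)) * F v w =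
          basis_elt x (d v \<otimes>\<^bsub>G\<^esub> d w) * (F v w * s (v \<otimes>\<^bsub>M\<^esub> w))"
        by (simp add: d supp v w)
      also have "\<dots> = s v * (basis_elt x (d v \<otimes>\<^bsub>G\<^esub> d w) * F' (d v) (d w) * s w)"
        by (simp add: s supp v w)
      finally show "s (v \<otimes>\<^bsub>M\<^esub> w) * basis_elt x (d (v \<otimes>\<^bsub>M\<^esub> w)) * F v w =
          s v * (basis_elt x (d v \<otimes>\<^bsub>G\<^esub> d w) * F' (d v) (d w) * s w)" .
    qed
    then show "pairing (\<lambda>w. s (v \<otimes>\<^bsub>M\<^esub> w) * basis_elt x (d (v \<otimes>\<^bsub>M\<^esub> w)) * F v w) b =
        pairing (\<lambda>w. basis_elt x (d v \<otimes>\<^bsub>G\<^esub> d w) * F' (d v) (d w) * s w) b * s v"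
      by (simp add: pairing_cmult_left)
  qed
  also have "\<dots> = (push s d a \<otimes>\<^bsub>twisted_monoid_algebra G F'\<^esub> push s d b) x"
    by (simp add: twisted_mult_apply[OF finite_support_push[OF fin(1)] finite_support_push[OF fin(2)]]
        pairing_push fin)
  finally show "push s d (a \<otimes>\<^bsub>twisted_monoid_algebra M F\<^esub> b) x =
      (push s d a \<otimes>\<^bsub>twisted_monoid_algebra G F'\<^esub> push s d b) x" .
qed

section \<open>Subtraction and induction on the support\<close>

context twisting
begin

text \<open>Negation in a ring record is only characterised by the ring axioms; cancelling
  \<open>b\<close> from the pointwise difference plus \<open>b\<close> identifies it.\<close>

lemma twisted_algebra_minus:
  assumes "a \<in> carrier T" and "b \<in> carrier T"
  shows "a \<ominus>\<^bsub>T\<^esub> b = (\<lambda>x. a x - b x)"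
proof -
  interpret A: ring T by (rule ring_twisted_algebra)
  have "{g. a g - b g \<noteq> 0} \<subseteq> {g. a g \<noteq> 0} \<union> {g. b g \<noteq> 0}" by auto
  then have closed: "(\<lambda>x. a x - b x) \<in> carrier T"
    using assms by (auto intro: finite_subset)
  have "x \<oplus>\<^bsub>T\<^esub> b \<ominus>\<^bsub>T\<^esub> b = x" if "x \<in> carrier T" for x
    using that assms(2) by (simp only: A.minus_eq A.a_assoc A.a_inv_closed A.r_neg A.r_zero)
  from this[OF closed] show ?thesis by simp
qed

text \<open>Peeling off one point of the finite support at a time reaches zero. The rule spreads
  statements about basis elements to the whole algebra when the property is linear.\<close>

lemma twisted_algebra_induct [consumes 1, case_names zero add]:
  assumes "a \<in> carrier T"
    and zero: "P (\<lambda>_. 0)"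
    and add: "\<And>a c g. g \<in> carrier M \<Longrightarrow> a \<in> carrier T \<Longrightarrow> P a \<Longrightarrow> P (\<lambda>x. c * basis_elt g x + a x)"
  shows "P a"
proof -
  have "\<forall>a. {g. a g \<noteq> 0} = S \<longrightarrow> P a" if "finite S" and "S \<subseteq> carrier M" for S
    using that
  proof (induction S)
    case empty
    show ?case
    proof (intro allI impI)
      fix a :: "'g \<Rightarrow> 'k" assume "{g. a g \<noteq> 0} = {}"
      then have "a = (\<lambda>_. 0)" by auto
      then show "P a" using zero by simp
    qed
  next
    case (insert h S)
    show ?case
    proof (intro allI impI)
      fix a :: "'g \<Rightarrow> 'k" assume a: "{g. a g \<noteq> 0} = insert h S"
      have supp: "{g. (a(h := 0)) g \<noteq> 0} = S" using a insert.hyps(2) by auto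
      have "P (\<lambda>x. a h * basis_elt h x + (a(h := 0)) x)"
        using insert supp by (intro add) auto
      moreover have "(\<lambda>x. a h * basis_elt h x + (a(h := 0)) x) = a"
        by (auto simp: basis_elt_def)
      ultimately show "P a" by simp
    qed
  qed
  then show ?thesis using assms(1) by auto
qed

end

section \<open>Ideals and quotients of associative algebras\<close>

context assoc_algebra
begin

text \<open>Scalars act as multiplication by the elements \<open>c \<odot> \<one>\<close>, so a ring
  ideal is automatically a subspace. This is why the ring ideal generated by the relations already
  yields a quotient algebra.\<close>

lemma ideal_smult_closed:
  assumes "ideal I A" and "c \<in> carrier K" and "x \<in> I"
  shows "c \<odot>\<^bsub>A\<^esub> x \<in> I"
proof -
  interpret I: ideal I A by fact
  have x: "x \<in> carrier A" using assms(3) by (rule I.a_Hcarr)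
  have "c \<odot>\<^bsub>A\<^esub> x = (c \<odot>\<^bsub>A\<^esub> \<one>\<^bsub>A\<^esub>) \<otimes>\<^bsub>A\<^esub> x"
    using assms(2) x by (simp add: smult_mult_left)
  then show ?thesis using assms by (simp add: I.I_l_closed)
qed

lemma smult_minus:
  assumes "c \<in> carrier K" and "x \<in> carrier A" and "y \<in> carrier A"
  shows "c \<odot>\<^bsub>A\<^esub> x \<ominus>\<^bsub>A\<^esub> c \<odot>\<^bsub>A\<^esub> y = c \<odot>\<^bsub>A\<^esub> (x \<ominus>\<^bsub>A\<^esub> y)"
  using assms by (simp add: a_minus_def smult_r_distr smult_r_minus)

end

context
  fixes A :: "('k::field, 'a) module" and I
  assumes A: "assoc_algebra class_ring A" and I: "ideal I A"
begin

interpretation assoc_algebra class_ring A by (rule A)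

text \<open>The union defining the scalar action runs over all representatives of a coset. Since the
  ideal is a subspace, every member of that union is the same coset.\<close>

lemma quotient_algebra_smult:
  assumes x: "x \<in> carrier A"
  shows "c \<odot>\<^bsub>quotient_algebra A I\<^esub> (I +>\<^bsub>A\<^esub> x) = I +>\<^bsub>A\<^esub> (c \<odot>\<^bsub>A\<^esub> x)"
proof -
  interpret I: ideal I A by (rule I)
  have "I +>\<^bsub>A\<^esub> (c \<odot>\<^bsub>A\<^esub> y) = I +>\<^bsub>A\<^esub> (c \<odot>\<^bsub>A\<^esub> x)" if y: "y \<in> I +>\<^bsub>A\<^esub> x" for y
  proof -
    have yc: "y \<in> carrier A"
      using x y by (rule I.a_elemrcos_carrier)
    have "I +>\<^bsub>A\<^esub> y = I +>\<^bsub>A\<^esub> x"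
      using I.a_repr_independence'[OF y x] by simp
    then have "y \<ominus>\<^bsub>A\<^esub> x \<in> I"
      using A.quotient_eq_iff_same_a_r_cos[OF I yc x] by simp
    then have "c \<odot>\<^bsub>A\<^esub> y \<ominus>\<^bsub>A\<^esub> c \<odot>\<^bsub>A\<^esub> x \<in> I"
      using ideal_smult_closed[OF I, of c] x yc by (simp add: smult_minus)
    then show ?thesis
      using A.quotient_eq_iff_same_a_r_cos[OF I] x yc by simp
  qed
  moreover have "I +>\<^bsub>A\<^esub> x \<noteq> {}" using I.a_rcos_self[OF x] by blast
  ultimately have "(\<Union>y\<in>I +>\<^bsub>A\<^esub> x. I +>\<^bsub>A\<^esub> (c \<odot>\<^bsub>A\<^esub> y)) = I +>\<^bsub>A\<^esub> (c \<odot>\<^bsub>A\<^esub> x)"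
    by (intro SUP_eq_const)
  then show ?thesis by (simp add: quotient_algebra_def)
qed

lemma assoc_algebra_quotient_algebra:
  "assoc_algebra class_ring (quotient_algebra A I)"
proof -
  interpret I: ideal I A by (rule I)
  let ?Q = "quotient_algebra A I"
  interpret Q: ring "A Quot I" by (rule I.quotient_is_ring)
  \<comment> \<open>The record \<open>?Q\<close> only adds a scalar action to
    \<open>A Quot I\<close>, so the ring laws are carried over selector by selector; the module laws
    below are checked on representatives.\<close>
  have sel: "carrier ?Q = carrier (A Quot I)" "x \<otimes>\<^bsub>?Q\<^esub> y = x \<otimes>\<^bsub>A Quot I\<^esub> y" "x \<oplus>\<^bsub>?Q\<^esub> y = x \<oplus>\<^bsub>A Quot I\<^esub> y"
    "\<one>\<^bsub>?Q\<^esub> = \<one>\<^bsub>A Quot I\<^esub>" "\<zero>\<^bsub>?Q\<^esub> = \<zero>\<^bsub>A Quot I\<^esub>" for x y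
    by (simp_all add: quotient_algebra_def)
  have ab: "abelian_group ?Q"
  proof (rule abelian_groupI)
    show "\<exists>y\<in>carrier ?Q. y \<oplus>\<^bsub>?Q\<^esub> x = \<zero>\<^bsub>?Q\<^esub>" if "x \<in> carrier ?Q" for x
      using that Q.l_neg unfolding sel by blast
  qed (simp_all add: sel Q.add.m_ac)
  have mon: "Group.monoid ?Q"
    by (rule monoidI) (simp_all add: sel Q.m_assoc)
  have ring: "ring ?Q"
    using ab mon by (rule ringI) (simp_all add: sel Q.l_distr Q.r_distr)
  note hom = I.rcos_ring_hom[THEN ring_hom_closed] I.rcos_ring_hom[THEN ring_hom_add, symmetric]
    I.rcos_ring_hom[THEN ring_hom_mult, symmetric]
  note laws = smult_l_distr[simplified] smult_assoc1[simplified] smult_one[simplified]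
    smult_r_distr[simplified] smult_mult_left[simplified] smult_mult_right[simplified]
  have rep: "\<exists>x'\<in>carrier A. x = I +>\<^bsub>A\<^esub> x'" if "x \<in> carrier ?Q" for x
    using that by (auto simp: sel FactRing_def A_RCOSETS_def')
  have "Module.module class_ring ?Q"
  proof (rule moduleI[OF class_cring.cring_axioms ab])
    fix c :: 'k and x assume "x \<in> carrier ?Q"
    then obtain x' where "x' \<in> carrier A" "x = I +>\<^bsub>A\<^esub> x'" using rep by blast
    then show "c \<odot>\<^bsub>?Q\<^esub> x \<in> carrier ?Q" "\<one>\<^bsub>class_ring\<^esub> \<odot>\<^bsub>?Q\<^esub> x = x"
      by (simp_all add: quotient_algebra_smult sel hom laws)
  next
    fix c e :: 'k and x assume "x \<in> carrier ?Q"
    then obtain x' where "x' \<in> carrier A" "x = I +>\<^bsub>A\<^esub> x'" using rep by blast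
    then show "(c \<oplus>\<^bsub>class_ring\<^esub> e) \<odot>\<^bsub>?Q\<^esub> x = c \<odot>\<^bsub>?Q\<^esub> x \<oplus>\<^bsub>?Q\<^esub> e \<odot>\<^bsub>?Q\<^esub> x"
      "(c \<otimes>\<^bsub>class_ring\<^esub> e) \<odot>\<^bsub>?Q\<^esub> x = c \<odot>\<^bsub>?Q\<^esub> (e \<odot>\<^bsub>?Q\<^esub> x)"
      by (simp_all add: quotient_algebra_smult sel hom laws)
  next
    fix c :: 'k and x y assume "x \<in> carrier ?Q" "y \<in> carrier ?Q"
    then obtain x' y' where "x' \<in> carrier A" "x = I +>\<^bsub>A\<^esub> x'" "y' \<in> carrier A" "y = I +>\<^bsub>A\<^esub> y'"
      using rep by blast
    then show "c \<odot>\<^bsub>?Q\<^esub> (x \<oplus>\<^bsub>?Q\<^esub> y) = c \<odot>\<^bsub>?Q\<^esub> x \<oplus>\<^bsub>?Q\<^esub> c \<odot>\<^bsub>?Q\<^esub> y"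
      by (simp add: quotient_algebra_smult sel hom laws)
  qed
  then have "vectorspace class_ring ?Q"
    by (simp add: vectorspace_def class_field)
  moreover have "assoc_algebra_axioms class_ring ?Q"
  proof
    fix c :: 'k and x y assume "x \<in> carrier ?Q" "y \<in> carrier ?Q"
    then obtain x' y' where "x' \<in> carrier A" "x = I +>\<^bsub>A\<^esub> x'" "y' \<in> carrier A" "y = I +>\<^bsub>A\<^esub> y'"
      using rep by blast
    then show "c \<odot>\<^bsub>?Q\<^esub> x \<otimes>\<^bsub>?Q\<^esub> y = c \<odot>\<^bsub>?Q\<^esub> (x \<otimes>\<^bsub>?Q\<^esub> y)"
      "x \<otimes>\<^bsub>?Q\<^esub> (c \<odot>\<^bsub>?Q\<^esub> y) = c \<odot>\<^bsub>?Q\<^esub> (x \<otimes>\<^bsub>?Q\<^esub> y)"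
      by (simp_all add: quotient_algebra_smult sel hom laws)
  qed
  ultimately show ?thesis
    using ring by (intro assoc_algebra.intro)
qed

end

section \<open>Presentations of twisted monoid algebras\<close>

lemma twisting_free_monoid: "twisting \<lparr>carrier = lists X, monoid.mult = (@), one = []\<rparr> (\<lambda>_ _. 1)"
  by unfold_locales auto

text \<open>
  \<open>N\<close> selects a representative (a normal form) in each fibre of \<open>d\<close>. The relations \<open>r\<close> present the
  target as soon as they hold there and reduce every \<open>w\<close> to a multiple of its normal form.
\<close>

locale presentation = M: twisting M E + G: twisting G F
  for M :: "('w, 'm) monoid_scheme" and E :: "'w \<Rightarrow> 'w \<Rightarrow> 'k::field"
    and G :: "('g, 'n) monoid_scheme" and F :: "'g \<Rightarrow> 'g \<Rightarrow> 'k" +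
  fixes d :: "'w \<Rightarrow> 'g" and s :: "'w \<Rightarrow> 'k" and N :: "'g \<Rightarrow> 'w" and r :: "('w \<Rightarrow> 'k) set"
  assumes d_closed: "w \<in> carrier M \<Longrightarrow> d w \<in> carrier G"
    and d_one: "d \<one>\<^bsub>M\<^esub> = \<one>\<^bsub>G\<^esub>"
    and d_mult: "\<lbrakk>v \<in> carrier M; w \<in> carrier M\<rbrakk> \<Longrightarrow> d (v \<otimes>\<^bsub>M\<^esub> w) = d v \<otimes>\<^bsub>G\<^esub> d w"
    and s_one: "s \<one>\<^bsub>M\<^esub> = 1"
    and s_mult: "\<lbrakk>v \<in> carrier M; w \<in> carrier M\<rbrakk> \<Longrightarrow>
      E v w * s (v \<otimes>\<^bsub>M\<^esub> w) = s v * s w * F (d v) (d w)"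
    and N_closed: "g \<in> carrier G \<Longrightarrow> N g \<in> carrier M"
    and d_N: "g \<in> carrier G \<Longrightarrow> d (N g) = g"
    and s_N: "g \<in> carrier G \<Longrightarrow> s (N g) = 1"
    and relations_closed: "r \<subseteq> carrier M.T"
    and relations_kernel: "a \<in> r \<Longrightarrow> push s d a = (\<lambda>_. 0)"
    and normal_form: "w \<in> carrier M \<Longrightarrow>
      (\<lambda>x. basis_elt w x - s w * basis_elt (N (d w)) x) \<in> Idl\<^bsub>M.T\<^esub> r"
begin

abbreviation "I \<equiv> Idl\<^bsub>M.T\<^esub> r"
abbreviation "Q \<equiv> quotient_algebra M.T I"
abbreviation "\<pi> \<equiv> push s d"
abbreviation "\<sigma> \<equiv> push (\<lambda>_. 1) N"
abbreviation "\<phi> \<equiv> \<lambda>f. I +>\<^bsub>M.T\<^esub> \<sigma> f"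

interpretation A: assoc_algebra class_ring M.T by (rule M.assoc_algebra_twisted_algebra)

lemma ideal_I: "ideal I M.T"
  using M.ring_twisted_algebra relations_closed by (intro ring.genideal_ideal)

lemma assoc_algebra_Q: "assoc_algebra class_ring Q"
  using M.assoc_algebra_twisted_algebra ideal_I by (rule assoc_algebra_quotient_algebra)

lemma \<pi>_closed: "a \<in> carrier M.T \<Longrightarrow> \<pi> a \<in> carrier G.T"
  by (erule push_closed) (rule d_closed)

lemma \<sigma>_closed: "f \<in> carrier G.T \<Longrightarrow> \<sigma> f \<in> carrier M.T"
  by (erule push_closed) (rule N_closed)

text \<open>A normal form has scalar 1 and lies in the fibre it represents, so the composite of the
  two pushes fixes each basis element.\<close>

lemma \<pi>_\<sigma>: "f \<in> carrier G.T \<Longrightarrow> \<pi> (\<sigma> f) = f"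
  by (subst push_push) (auto intro!: push_identity simp: s_N d_N subset_iff)

lemma ring_hom_\<pi>: "ring_hom_ring M.T G.T \<pi>"
proof (rule ring_hom_ringI[OF M.ring_twisted_algebra G.ring_twisted_algebra])
  show "\<pi> (a \<otimes>\<^bsub>M.T\<^esub> b) = \<pi> a \<otimes>\<^bsub>G.T\<^esub> \<pi> b" if "a \<in> carrier M.T" "b \<in> carrier M.T" for a b
    using that d_mult s_mult by (rule push_mult)
qed (rule \<pi>_closed, simp_all add: push_add push_basis_elt d_one s_one)

text \<open>The kernel of \<open>\<pi>\<close> is an ideal containing the relations, and
  \<open>I\<close> is the least such ideal.\<close>

lemma I_subset_kernel:
  assumes "a \<in> I"
  shows "\<pi> a = (\<lambda>_. 0)"
proof -
  have "I \<subseteq> a_kernel M.T G.T \<pi>"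
    using ring_hom_ring.kernel_is_ideal[OF ring_hom_\<pi>]
  proof (rule ring.genideal_minimal[OF M.ring_twisted_algebra])
    show "r \<subseteq> a_kernel M.T G.T \<pi>"
      using relations_closed relations_kernel unfolding a_kernel_def' by (auto simp del: twisted_monoid_algebra_simps(1))
  qed
  with assms show ?thesis unfolding a_kernel_def' by auto
qed

text \<open>For basis elements this is the assumption \<open>normal_form\<close>; the expression is
  linear in \<open>a\<close> and \<open>I\<close> is a subspace. It contains the harder inclusion:
  an element killed by \<open>\<pi>\<close> lies in \<open>I\<close>.\<close>

lemma minus_\<sigma>_\<pi>:
  assumes "a \<in> carrier M.T"
  shows "(\<lambda>x. a x - \<sigma> (\<pi> a) x) \<in> I"
  using assms
proof (induction a rule: M.twisted_algebra_induct)
  case zero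
  interpret I: ideal I M.T by (rule ideal_I)
  show ?case using I.zero_closed by (simp add: push_def)
next
  case (add a c w)
  interpret I: ideal I M.T by (rule ideal_I)
  have fin: "finite {x. c * basis_elt w x \<noteq> 0}" "finite {x. a x \<noteq> 0}"
    using M.twisted_algebra_smult_closed[OF M.basis_elt_closed[OF add(1)], of c] add(2) by simp_all
  have \<pi>: "\<pi> (\<lambda>x. c * basis_elt w x + a x) = (\<lambda>g. c * s w * basis_elt (d w) g + \<pi> a g)"
    by (simp add: push_add[OF fin] push_cmult push_basis_elt mult.assoc)
  have fin': "finite {g. c * s w * basis_elt (d w) g \<noteq> 0}" "finite {g. \<pi> a g \<noteq> 0}"
    using G.twisted_algebra_smult_closed[OF G.basis_elt_closed[OF d_closed[OF add(1)]], of "c * s w"]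
      \<pi>_closed[OF add(2)] by simp_all
  have \<sigma>: "\<sigma> (\<pi> (\<lambda>x. c * basis_elt w x + a x)) =
      (\<lambda>x. c * s w * basis_elt (N (d w)) x + \<sigma> (\<pi> a) x)"
    unfolding \<pi> by (simp add: push_add[OF fin'] push_cmult push_basis_elt)
  have "c \<odot>\<^bsub>M.T\<^esub> (\<lambda>x. basis_elt w x - s w * basis_elt (N (d w)) x) \<oplus>\<^bsub>M.T\<^esub> (\<lambda>x. a x - \<sigma> (\<pi> a) x) \<in> I"
    using A.ideal_smult_closed[OF ideal_I, of c] normal_form[OF add(1)] add(3)
    by (intro I.a_closed) simp_all
  then show ?case unfolding \<sigma> by (simp add: algebra_simps)
qed

text \<open>Through \<open>\<pi>\<close>, the map \<open>\<phi>\<close> is the canonical projection,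
  from which it inherits its algebraic properties and its surjectivity.\<close>

lemma \<phi>_\<pi>:
  assumes "a \<in> carrier M.T"
  shows "\<phi> (\<pi> a) = I +>\<^bsub>M.T\<^esub> a"
proof -
  have c: "\<sigma> (\<pi> a) \<in> carrier M.T" using assms by (intro \<sigma>_closed \<pi>_closed)
  have "a \<ominus>\<^bsub>M.T\<^esub> \<sigma> (\<pi> a) \<in> I"
    unfolding M.twisted_algebra_minus[OF assms c] by (rule minus_\<sigma>_\<pi>[OF assms])
  then show ?thesis
    using ring.quotient_eq_iff_same_a_r_cos[OF M.ring_twisted_algebra ideal_I assms c] by simp
qed

text \<open>Equal classes mean that \<open>\<sigma> f\<close> and \<open>\<sigma> g\<close> differ
  by an element of \<open>I\<close>; applying \<open>\<pi>\<close> kills that element and recovers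
  \<open>f\<close> and \<open>g\<close>.\<close>

lemma inj_on_\<phi>: "inj_on \<phi> (carrier G.T)"
proof (rule inj_onI)
  fix f g assume f: "f \<in> carrier G.T" and g: "g \<in> carrier G.T" and eq: "\<phi> f = \<phi> g"
  interpret \<pi>: ring_hom_ring M.T G.T \<pi> by (rule ring_hom_\<pi>)
  have "\<sigma> f \<ominus>\<^bsub>M.T\<^esub> \<sigma> g \<in> I"
    using eq ring.quotient_eq_iff_same_a_r_cos[OF M.ring_twisted_algebra ideal_I \<sigma>_closed[OF f] \<sigma>_closed[OF g]]
    by simp
  then have "\<pi> (\<sigma> f \<ominus>\<^bsub>M.T\<^esub> \<sigma> g) = (\<lambda>_. 0)" by (rule I_subset_kernel)
  moreover have "\<pi> (\<sigma> f \<ominus>\<^bsub>M.T\<^esub> \<sigma> g) = \<pi> (\<sigma> f) \<ominus>\<^bsub>G.T\<^esub> \<pi> (\<sigma> g)"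
    using \<sigma>_closed[OF f] \<sigma>_closed[OF g]
    by (simp only: a_minus_def \<pi>.hom_add \<pi>.hom_a_inv abelian_group.a_inv_closed[OF M.abelian_group_twisted_algebra])
  ultimately have "(\<lambda>x. f x - g x) = (\<lambda>_. 0)"
    unfolding \<pi>_\<sigma>[OF f] \<pi>_\<sigma>[OF g] G.twisted_algebra_minus[OF f g] by simp
  then show "f = g" by (simp add: fun_eq_iff)
qed

lemma algebra_iso_presentation: "algebra_iso G.T Q \<phi>"
proof -
  interpret I: ideal I M.T by (rule ideal_I)
  interpret \<pi>: ring_hom_ring M.T G.T \<pi> by (rule ring_hom_\<pi>)
  have sel: "carrier Q = carrier (M.T Quot I)" "x \<otimes>\<^bsub>Q\<^esub> y = x \<otimes>\<^bsub>M.T Quot I\<^esub> y"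
    "x \<oplus>\<^bsub>Q\<^esub> y = x \<oplus>\<^bsub>M.T Quot I\<^esub> y" "\<one>\<^bsub>Q\<^esub> = \<one>\<^bsub>M.T Quot I\<^esub>" for x y
    by (simp_all add: quotient_algebra_def)
  note p = I.rcos_ring_hom
  have "\<phi> \<in> Ring.ring_hom G.T Q"
  proof (rule ring_hom_memI)
    fix f assume f: "f \<in> carrier G.T"
    show "\<phi> f \<in> carrier Q"
      unfolding sel using ring_hom_closed[OF p \<sigma>_closed[OF f]] .
    fix g assume g: "g \<in> carrier G.T"
    \<comment> \<open>The section \<open>\<sigma>\<close> need not be multiplicative, so the product
      is first written as an image under \<open>\<pi>\<close>, where \<open>\<phi>\<close> is the
      canonical projection.\<close>
    have "\<phi> (f \<otimes>\<^bsub>G.T\<^esub> g) = \<phi> (\<pi> (\<sigma> f \<otimes>\<^bsub>M.T\<^esub> \<sigma> g))"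
      using f g by (simp only: \<pi>.hom_mult \<sigma>_closed \<pi>_\<sigma>)
    also have "\<dots> = I +>\<^bsub>M.T\<^esub> (\<sigma> f \<otimes>\<^bsub>M.T\<^esub> \<sigma> g)"
      using f g by (intro \<phi>_\<pi> M.twisted_algebra_mult_closed \<sigma>_closed)
    also have "\<dots> = \<phi> f \<otimes>\<^bsub>Q\<^esub> \<phi> g"
      unfolding sel using f g by (intro ring_hom_mult[OF p] \<sigma>_closed)
    finally show "\<phi> (f \<otimes>\<^bsub>G.T\<^esub> g) = \<phi> f \<otimes>\<^bsub>Q\<^esub> \<phi> g" .
    have "\<phi> (f \<oplus>\<^bsub>G.T\<^esub> g) = \<phi> (\<pi> (\<sigma> f \<oplus>\<^bsub>M.T\<^esub> \<sigma> g))"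
      using f g by (simp only: \<pi>.hom_add \<sigma>_closed \<pi>_\<sigma>)
    also have "\<dots> = I +>\<^bsub>M.T\<^esub> (\<sigma> f \<oplus>\<^bsub>M.T\<^esub> \<sigma> g)"
      using f g by (intro \<phi>_\<pi> M.twisted_algebra_add_closed \<sigma>_closed)
    also have "\<dots> = \<phi> f \<oplus>\<^bsub>Q\<^esub> \<phi> g"
      unfolding sel using f g by (intro ring_hom_add[OF p] \<sigma>_closed)
    finally show "\<phi> (f \<oplus>\<^bsub>G.T\<^esub> g) = \<phi> f \<oplus>\<^bsub>Q\<^esub> \<phi> g" .
  next
    have "\<phi> \<one>\<^bsub>G.T\<^esub> = \<phi> (\<pi> \<one>\<^bsub>M.T\<^esub>)" by (simp only: \<pi>.hom_one)
    also have "\<dots> = \<one>\<^bsub>Q\<^esub>"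
      unfolding sel ring_hom_one[OF p, symmetric] by (intro \<phi>_\<pi> monoid.one_closed M.monoid_twisted_algebra)
    finally show "\<phi> \<one>\<^bsub>G.T\<^esub> = \<one>\<^bsub>Q\<^esub>" .
  qed
  moreover have "carrier Q \<subseteq> \<phi> ` carrier G.T"
  proof
    fix X assume "X \<in> carrier Q"
    then obtain a where a: "a \<in> carrier M.T" and X: "X = I +>\<^bsub>M.T\<^esub> a"
      unfolding sel FactRing_def A_RCOSETS_def' by auto
    show "X \<in> \<phi> ` carrier G.T"
      unfolding X \<phi>_\<pi>[OF a, symmetric] using \<pi>_closed[OF a] by (rule imageI)
  qed
  ultimately have iso: "\<phi> \<in> ring_iso G.T Q"
    using inj_on_\<phi> ring_hom_closed[of \<phi> G.T Q] unfolding ring_iso_def bij_betw_def by blast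
  have "\<phi> (c \<odot>\<^bsub>G.T\<^esub> f) = c \<odot>\<^bsub>Q\<^esub> \<phi> f" if f: "f \<in> carrier G.T" for c f
    unfolding quotient_algebra_smult[OF M.assoc_algebra_twisted_algebra ideal_I \<sigma>_closed[OF f]]
    by (simp add: push_cmult)
  then show ?thesis
    unfolding algebra_iso_def
    using G.assoc_algebra_twisted_algebra assoc_algebra_Q iso by blast
qed

end

section \<open>Transporting the grading\<close>

context twisting
begin

lemma smult_basis_elt_closed: "g \<in> carrier M \<Longrightarrow> c \<odot>\<^bsub>T\<^esub> basis_elt g \<in> carrier T"
  by (intro twisted_algebra_smult_closed basis_elt_closed)

context
  fixes C :: "('k, 'a) module" and \<phi> :: "('g \<Rightarrow> 'k) \<Rightarrow> 'a"
  assumes iso: "algebra_iso T C \<phi>"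
begin

interpretation C: assoc_algebra class_ring C
  using iso by (simp add: algebra_iso_def)

private lemma hom: "\<phi> \<in> Ring.ring_hom T C" and bij: "bij_betw \<phi> (carrier T) (carrier C)"
  using iso by (simp_all add: algebra_iso_def ring_iso_def del: twisted_monoid_algebra_simps(1))

private lemma iso_smult: "f \<in> carrier T \<Longrightarrow> \<phi> (c \<odot>\<^bsub>T\<^esub> f) = c \<odot>\<^bsub>C\<^esub> \<phi> f"
  using iso by (simp add: algebra_iso_def del: twisted_monoid_algebra_simps(1))

private lemmas iso_closed = ring_hom_closed[OF hom]
private lemmas iso_add = ring_hom_add[OF hom]
private lemmas iso_mult = ring_hom_mult[OF hom]

private lemma zero_T_closed: "(\<lambda>_. 0) \<in> carrier T"
  by simp

private lemma iso_zero: "\<phi> (\<lambda>_. 0) = \<zero>\<^bsub>C\<^esub>"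
  using iso_smult[of "\<lambda>_. 0" 0] iso_closed[OF zero_T_closed] C.smult_l_null[of "\<phi> (\<lambda>_. 0)"] by simp

text \<open>The line spanned by the image of a basis element. The set is written exactly as the
  grading in \<open>algebra_in_symmetric_Gr_category_iso\<close>, so that the name can be folded
  there.\<close>

definition homogeneous_part :: "'g \<Rightarrow> 'a set"
  where "homogeneous_part g = {\<phi> (c \<odot>\<^bsub>T\<^esub> basis_elt g) | c. True}"

lemma subspace_homogeneous_part:
  assumes g: "g \<in> carrier M"
  shows "subspace class_ring (homogeneous_part g) C"
proof (intro subspace.intro submodule.intro)
  show "vectorspace class_ring C" by (rule C.vectorspace_axioms)
  show "Module.module class_ring C" by (rule C.module_axioms)
  show "homogeneous_part g \<subseteq> carrier C"
    unfolding homogeneous_part_def using iso_closed[OF smult_basis_elt_closed[OF g]] by blast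
  show "\<zero>\<^bsub>C\<^esub> \<in> homogeneous_part g"
    unfolding homogeneous_part_def using iso_zero by (auto intro!: exI[of _ 0])
next
  fix x y assume "x \<in> homogeneous_part g" "y \<in> homogeneous_part g"
  then obtain c e where "x = \<phi> (c \<odot>\<^bsub>T\<^esub> basis_elt g)" "y = \<phi> (e \<odot>\<^bsub>T\<^esub> basis_elt g)"
    unfolding homogeneous_part_def by blast
  then have "x \<oplus>\<^bsub>C\<^esub> y = \<phi> ((c + e) \<odot>\<^bsub>T\<^esub> basis_elt g)"
    using iso_add[OF smult_basis_elt_closed[OF g, of c] smult_basis_elt_closed[OF g, of e], symmetric]
    by (simp add: distrib_right)
  then show "x \<oplus>\<^bsub>C\<^esub> y \<in> homogeneous_part g" unfolding homogeneous_part_def by blast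
next
  fix e :: 'k and x assume "x \<in> homogeneous_part g"
  then obtain c where "x = \<phi> (c \<odot>\<^bsub>T\<^esub> basis_elt g)" unfolding homogeneous_part_def by blast
  then have "e \<odot>\<^bsub>C\<^esub> x = \<phi> ((e * c) \<odot>\<^bsub>T\<^esub> basis_elt g)"
    using iso_smult[OF smult_basis_elt_closed[OF g, of c], of e, symmetric] by (simp add: mult.assoc)
  then show "e \<odot>\<^bsub>C\<^esub> x \<in> homogeneous_part g" unfolding homogeneous_part_def by blast
qed

lemma homogeneous_part_mult:
  assumes g: "g \<in> carrier M" and h: "h \<in> carrier M" and x: "x \<in> homogeneous_part g" and y: "y \<in> homogeneous_part h"
  shows "x \<otimes>\<^bsub>C\<^esub> y \<in> homogeneous_part (g \<otimes> h)"
proof -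
  interpret A: assoc_algebra class_ring T by (rule assoc_algebra_twisted_algebra)
  obtain c e where x: "x = \<phi> (c \<odot>\<^bsub>T\<^esub> basis_elt g)" and y: "y = \<phi> (e \<odot>\<^bsub>T\<^esub> basis_elt h)"
    using x y unfolding homogeneous_part_def by blast
  have "(c \<odot>\<^bsub>T\<^esub> basis_elt g) \<otimes>\<^bsub>T\<^esub> (e \<odot>\<^bsub>T\<^esub> basis_elt h) =
      c \<odot>\<^bsub>T\<^esub> (e \<odot>\<^bsub>T\<^esub> (basis_elt g \<otimes>\<^bsub>T\<^esub> basis_elt h))"
    using A.smult_mult_left[of c "basis_elt g" "e \<odot>\<^bsub>T\<^esub> basis_elt h"]
      A.smult_mult_right[of e "basis_elt g" "basis_elt h"]
      basis_elt_closed[OF g] basis_elt_closed[OF h] smult_basis_elt_closed[OF h, of e]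
    by simp
  also have "\<dots> = (c * e * F g h) \<odot>\<^bsub>T\<^esub> basis_elt (g \<otimes> h)"
    by (simp add: basis_elt_mult mult.assoc)
  finally have prod: "(c \<odot>\<^bsub>T\<^esub> basis_elt g) \<otimes>\<^bsub>T\<^esub> (e \<odot>\<^bsub>T\<^esub> basis_elt h) =
      (c * e * F g h) \<odot>\<^bsub>T\<^esub> basis_elt (g \<otimes> h)" .
  have "x \<otimes>\<^bsub>C\<^esub> y = \<phi> ((c * e * F g h) \<odot>\<^bsub>T\<^esub> basis_elt (g \<otimes> h))"
    unfolding x y prod[symmetric]
    by (rule iso_mult[OF smult_basis_elt_closed[OF g] smult_basis_elt_closed[OF h], symmetric])
  then show ?thesis unfolding homogeneous_part_def by blast
qed

text \<open>A sum of homogeneous elements is the image of the function listing their coefficients.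
  Existence and uniqueness of decompositions thereby become statements about functions and the
  bijection \<open>\<phi>\<close>.\<close>

lemma finsum_homogeneous_parts:
  assumes "finite S" and "S \<subseteq> carrier M"
  shows "(\<Oplus>\<^bsub>C\<^esub>g\<in>S. \<phi> (c g \<odot>\<^bsub>T\<^esub> basis_elt g)) = \<phi> (\<lambda>x. if x \<in> S then c x else 0)"
  using assms
proof (induction S)
  case empty
  show ?case by (simp add: iso_zero)
next
  case (insert h S)
  then have h: "h \<in> carrier M" and S: "S \<subseteq> carrier M" by auto
  have "(\<lambda>x. if x \<in> S then c x else 0) \<in> carrier T"
    using S insert(1) by (auto intro: finite_subset[of _ S])
  note add = iso_add[OF smult_basis_elt_closed[OF h, of "c h"] this]
  have "(\<Oplus>\<^bsub>C\<^esub>g\<in>insert h S. \<phi> (c g \<odot>\<^bsub>T\<^esub> basis_elt g)) =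
      \<phi> (c h \<odot>\<^bsub>T\<^esub> basis_elt h) \<oplus>\<^bsub>C\<^esub> (\<Oplus>\<^bsub>C\<^esub>g\<in>S. \<phi> (c g \<odot>\<^bsub>T\<^esub> basis_elt g))"
    using insert(1,2) iso_closed[OF smult_basis_elt_closed[OF h, of "c h"]]
      iso_closed[OF smult_basis_elt_closed] S
    by (intro C.finsum_insert) (auto simp del: twisted_monoid_algebra_simps)
  also have "\<dots> = \<phi> ((c h \<odot>\<^bsub>T\<^esub> basis_elt h) \<oplus>\<^bsub>T\<^esub> (\<lambda>x. if x \<in> S then c x else 0))"
    using insert.IH[OF S] add by simp
  also have "(c h \<odot>\<^bsub>T\<^esub> basis_elt h) \<oplus>\<^bsub>T\<^esub> (\<lambda>x. if x \<in> S then c x else 0) =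
      (\<lambda>x. if x \<in> insert h S then c x else 0)"
    using insert(2) by (auto simp: basis_elt_def)
  finally show ?case .
qed

lemma homogeneous_part_decomposition:
  assumes fin: "finite (carrier M)" and a: "a \<in> carrier C"
  shows "\<exists>!c. c \<in> (\<Pi>\<^sub>E g\<in>carrier M. homogeneous_part g) \<and> a = (\<Oplus>\<^bsub>C\<^esub>g\<in>carrier M. c g)"
proof -
  obtain f where f: "f \<in> carrier T" and a: "a = \<phi> f"
    using bij a unfolding bij_betw_def by blast
  have sum: "(\<Oplus>\<^bsub>C\<^esub>g\<in>carrier M. c g) = \<phi> (\<lambda>x. if x \<in> carrier M then e x else 0)"
    if "\<And>g. g \<in> carrier M \<Longrightarrow> c g = \<phi> (e g \<odot>\<^bsub>T\<^esub> basis_elt g)" for c e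
  proof -
    have "(\<Oplus>\<^bsub>C\<^esub>g\<in>carrier M. c g) = (\<Oplus>\<^bsub>C\<^esub>g\<in>carrier M. \<phi> (e g \<odot>\<^bsub>T\<^esub> basis_elt g))"
      using that iso_closed[OF smult_basis_elt_closed] by (intro C.finsum_cong') auto
    then show ?thesis using finsum_homogeneous_parts[OF fin subset_refl] by simp
  qed
  have f_eq: "(\<lambda>x. if x \<in> carrier M then f x else 0) = f"
    using f by (auto simp: fun_eq_iff subset_iff)
  show ?thesis
  proof (rule ex1I)
    \<comment> \<open>The coefficients are the values of the preimage \<open>f\<close>; the
      restriction gives the family the value \<open>undefined\<close> off the group, as membership
      in the extensional product demands.\<close>
    let ?c = "\<lambda>g\<in>carrier M. \<phi> (f g \<odot>\<^bsub>T\<^esub> basis_elt g)"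
    have "?c \<in> (\<Pi>\<^sub>E g\<in>carrier M. homogeneous_part g)"
      unfolding homogeneous_part_def by (rule restrict_PiE_iff[THEN iffD2]) blast
    moreover have "a = (\<Oplus>\<^bsub>C\<^esub>g\<in>carrier M. ?c g)"
      using sum[of ?c f] by (simp add: f_eq a)
    ultimately show "?c \<in> (\<Pi>\<^sub>E g\<in>carrier M. homogeneous_part g) \<and> a = (\<Oplus>\<^bsub>C\<^esub>g\<in>carrier M. ?c g)" ..
    fix c assume c: "c \<in> (\<Pi>\<^sub>E g\<in>carrier M. homogeneous_part g) \<and> a = (\<Oplus>\<^bsub>C\<^esub>g\<in>carrier M. c g)"
    then have "\<forall>g\<in>carrier M. \<exists>e. c g = \<phi> (e \<odot>\<^bsub>T\<^esub> basis_elt g)"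
      unfolding homogeneous_part_def by (auto simp: PiE_iff)
    then obtain e where e: "\<And>g. g \<in> carrier M \<Longrightarrow> c g = \<phi> (e g \<odot>\<^bsub>T\<^esub> basis_elt g)"
      by metis
    have closed: "(\<lambda>x. if x \<in> carrier M then e x else 0) \<in> carrier T"
      using fin by (auto intro: finite_subset)
    have "\<phi> f = \<phi> (\<lambda>x. if x \<in> carrier M then e x else 0)"
      using sum[OF e] c a by simp
    then have "f = (\<lambda>x. if x \<in> carrier M then e x else 0)"
      using bij f closed unfolding bij_betw_def by (meson inj_onD)
    then have "c g = ?c g" if "g \<in> carrier M" for g
      using that e by simp
    then show "c = ?c" using c by (intro PiE_ext) auto
  qed
qed

text \<open>The images of the basis elements are finitely many and span: their span is closed under
  the steps of \<open>twisted_algebra_induct\<close>.\<close>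

lemma fin_dim_target:
  assumes fin: "finite (carrier M)"
  shows "C.fin_dim"
proof -
  let ?B = "\<phi> ` basis_elt ` carrier M"
  have B: "?B \<subseteq> carrier C" using iso_closed[OF basis_elt_closed] by blast
  interpret S: submodule class_ring "C.span ?B" C
    using B by (rule C.span_is_submodule)
  have "\<phi> f \<in> C.span ?B" if "f \<in> carrier T" for f
    using that
  proof (induction f rule: twisted_algebra_induct)
    case zero
    show ?case using S.zero_closed by (simp add: iso_zero)
  next
    case (add f c g)
    have "\<phi> (basis_elt g) \<in> C.span ?B"
      using add(1) C.in_own_span[OF B] by blast
    then have "c \<odot>\<^bsub>C\<^esub> \<phi> (basis_elt g) \<oplus>\<^bsub>C\<^esub> \<phi> f \<in> C.span ?B"
      using add(3) by (intro S.m_closed S.smult_closed) simp_all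
    then show ?case
      using iso_add[OF smult_basis_elt_closed[OF add(1), of c] add(2)]
        iso_smult[OF basis_elt_closed[OF add(1)], of c] by simp
  qed
  then have "\<phi> ` carrier T \<subseteq> C.span ?B" by (rule image_subsetI)
  then have "carrier C \<subseteq> C.span ?B" by (simp only: bij_betw_imp_surj_on[OF bij])
  with S.subset have gen: "C.gen_set ?B" by (rule subset_antisym)
  show ?thesis
    unfolding C.fin_dim_def by (intro exI[of _ ?B] conjI finite_imageI fin B gen)
qed

end

end

lemma algebra_in_symmetric_Gr_category_iso:
  fixes G :: "'g monoid" and F R :: "'g \<Rightarrow> 'g \<Rightarrow> 'k::field"
  defines "T \<equiv> twisted_monoid_algebra G F"
  assumes "twisting G F" and R: "symmetric_Gr_category G R" and iso: "algebra_iso T C \<phi>"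
  shows "algebra_in_symmetric_Gr_category G R C (\<lambda>g. {\<phi> (c \<odot>\<^bsub>T\<^esub> basis_elt g) | c. True})"
proof -
  interpret twisting G F by fact
  have fin: "finite (carrier G)"
    using R by (rule symmetric_Gr_category.finite_group)
  note iso = iso[unfolded T_def]
  have C: "assoc_algebra class_ring C"
    using iso by (simp add: algebra_iso_def)
  show ?thesis
    unfolding algebra_in_symmetric_Gr_category_def T_def homogeneous_part_def[OF iso, symmetric]
    by (intro conjI ballI R C fin_dim_target[OF iso fin] subspace_homogeneous_part[OF iso]
        homogeneous_part_decomposition[OF iso fin] homogeneous_part_mult[OF iso])
qed

section \<open>The twisting on \<open>\<int>\<^sub>n\<^sup>m\<close>\<close>

lemma Zn_power_simps:
  assumes "n > 0"
  shows "carrier (Zn_power n m) = (\<Pi>\<^sub>E i\<in>{1..m}. {0..<int n})"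
    and "\<one>\<^bsub>Zn_power n m\<^esub> = (\<lambda>i\<in>{1..m}. 0)"
    and "g \<otimes>\<^bsub>Zn_power n m\<^esub> h = (\<lambda>i\<in>{1..m}. (g i + h i) mod int n)"
  using assms by (simp_all add: Zn_power_def carrier_integer_mod_group)

lemma comm_group_Zn_power: "comm_group (Zn_power n m)"
proof (rule group.group_comm_groupI)
  show "Group.group (Zn_power n m)" by (simp add: Zn_power_def)
qed (simp add: Zn_power_def add.commute)

lemma finite_carrier_Zn_power:
  "n > 0 \<Longrightarrow> finite (carrier (Zn_power n m))"
  unfolding Zn_power_simps(1) by (rule finite_PiE) simp_all

locale clifford_data =
  fixes n m :: nat and \<omega> :: "'k::field" and q :: "nat \<Rightarrow> 'k"
  assumes n_ge_2: "n \<ge> 2" and root_pow: "\<omega> ^ n = 1"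
    and q_nonzero: "i \<in> {1..m} \<Longrightarrow> q i \<noteq> 0"
begin

abbreviation "G \<equiv> Zn_power n m"
abbreviation "F \<equiv> F_GCA n m \<omega> q"

lemma n_pos: "n > 0"
  using n_ge_2 by simp

lemma root_nonzero: "\<omega> \<noteq> 0"
  using root_pow n_pos by (auto simp: power_0_left)

text \<open>Exponents are integers while the group operation reduces coordinates modulo
  \<open>n\<close>; since \<open>\<omega> ^ n = 1\<close>, the difference is invisible to powers of
  \<open>\<omega>\<close>.\<close>

lemma root_powi_cong:
  assumes "int n dvd a - b"
  shows "\<omega> powi a = \<omega> powi b"
proof -
  obtain k where "a = b + int n * k" using assms by (metis diff_eq_eq add.commute dvdE)
  then show ?thesis
    by (simp add: power_int_add root_nonzero power_int_mult root_pow)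
qed

text \<open>The integer exponent of \<open>\<omega>\<close> in \<open>F\<close>. With the group
  operation of \<open>G\<close> it is biadditive only up to multiples of \<open>n\<close>, which
  suffices to make its power of \<open>\<omega>\<close> a bicharacter.\<close>

definition twist_form :: "(nat \<Rightarrow> int) \<Rightarrow> (nat \<Rightarrow> int) \<Rightarrow> int"
  where "twist_form g h = (\<Sum>i = 1..m. \<Sum>j = 1..<i. g i * h j)"

lemma F_eq: "F g h = \<omega> powi twist_form g h * (\<Prod>i = 1..m. q i powi ((g i + h i) div int n))"
  by (simp add: F_GCA_def twist_form_def)

lemma mod_n_diff: "int n dvd ((a + b) mod int n) - (a + b)"
  by (simp add: mod_eq_dvd_iff[symmetric])

lemma twist_form_mult_left:
  "int n dvd twist_form (g \<otimes>\<^bsub>G\<^esub> h) l - (twist_form g l + twist_form h l)"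
proof -
  have "twist_form (g \<otimes>\<^bsub>G\<^esub> h) l - (twist_form g l + twist_form h l) =
      (\<Sum>i = 1..m. \<Sum>j = 1..<i. ((g i + h i) mod int n - (g i + h i)) * l j)"
    unfolding twist_form_def sum.distrib[symmetric] sum_subtractf[symmetric]
    by (intro sum.cong refl) (simp add: Zn_power_simps(3)[OF n_pos] algebra_simps)
  also have "int n dvd \<dots>"
    by (intro dvd_sum dvd_mult2 mod_n_diff)
  finally show ?thesis .
qed

lemma twist_form_mult_right:
  "int n dvd twist_form g (h \<otimes>\<^bsub>G\<^esub> l) - (twist_form g h + twist_form g l)"
proof -
  have "twist_form g (h \<otimes>\<^bsub>G\<^esub> l) - (twist_form g h + twist_form g l) =
      (\<Sum>i = 1..m. \<Sum>j = 1..<i. g i * ((h j + l j) mod int n - (h j + l j)))"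
    unfolding twist_form_def sum.distrib[symmetric] sum_subtractf[symmetric]
    by (intro sum.cong refl) (simp add: Zn_power_simps(3)[OF n_pos] algebra_simps)
  also have "int n dvd \<dots>"
    by (intro dvd_sum dvd_mult mod_n_diff)
  finally show ?thesis .
qed

lemma root_twist_mult_left:
  "\<omega> powi twist_form (g \<otimes>\<^bsub>G\<^esub> h) l = \<omega> powi twist_form g l * \<omega> powi twist_form h l"
  using root_powi_cong[OF twist_form_mult_left] by (simp add: power_int_add root_nonzero)

lemma root_twist_mult_right:
  "\<omega> powi twist_form g (h \<otimes>\<^bsub>G\<^esub> l) = \<omega> powi twist_form g h * \<omega> powi twist_form g l"
  using root_powi_cong[OF twist_form_mult_right] by (simp add: power_int_add root_nonzero)

lemma carrier_G_range: "g \<in> carrier G \<Longrightarrow> i \<in> {1..m} \<Longrightarrow> 0 \<le> g i \<and> g i < int n"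
  by (auto simp: Zn_power_simps(1)[OF n_pos])

text \<open>Both sides equal \<open>(a + b + c) div int n\<close>, the total carry, in whichever
  order the three summands are added.\<close>

lemma carry_cocycle:
  "(a + b) div int n + ((a + b) mod int n + c) div int n =
    (b + c) div int n + (a + (b + c) mod int n) div int n"
proof -
  have "(x + y) div int n + ((x + y) mod int n + z) div int n = (x + y + z) div int n" for x y z
  proof -
    have "x + y + z = ((x + y) mod int n + z) + int n * ((x + y) div int n)"
      by (simp add: algebra_simps)
    moreover have "(r + int n * k) div int n = k + r div int n" for r k
      using n_pos by simp
    ultimately show ?thesis by metis
  qed
  from this[of a b c] this[of b c a] show ?thesis by (simp add: ac_simps)
qed

text \<open>A bicharacter is a cocycle, and the factor in the \<open>q i\<close> is one by
  \<open>carry_cocycle\<close>, coordinate by coordinate. Adding zero to a reduced representative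
  produces no carry, hence the normalisation.\<close>

lemma twisting_F: "twisting G F"
proof -
  interpret comm_group G by (rule comm_group_Zn_power)
  show ?thesis
  proof unfold_locales
    fix g assume g: "g \<in> carrier G"
    have "(\<Prod>i = 1..m. q i powi (g i div int n)) = (\<Prod>i = 1..m. 1)"
      using carrier_G_range[OF g] by (intro prod.cong refl) simp
    then show "F \<one>\<^bsub>G\<^esub> g = 1" "F g \<one>\<^bsub>G\<^esub> = 1"
      by (simp_all add: F_eq twist_form_def Zn_power_simps(2)[OF n_pos])
  next
    fix g h l assume "g \<in> carrier G" "h \<in> carrier G" "l \<in> carrier G"
    let ?P = "\<lambda>g h. \<Prod>i = 1..m. q i powi ((g i + h i) div int n)"
    have "?P g h * ?P (g \<otimes>\<^bsub>G\<^esub> h) l = ?P h l * ?P g (h \<otimes>\<^bsub>G\<^esub> l)"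
      unfolding prod.distrib[symmetric]
      by (intro prod.cong refl)
        (simp add: Zn_power_simps(3)[OF n_pos] power_int_add[symmetric] q_nonzero carry_cocycle)
    then show "F g h * F (g \<otimes>\<^bsub>G\<^esub> h) l = F h l * F g (h \<otimes>\<^bsub>G\<^esub> l)"
      unfolding F_eq root_twist_mult_left root_twist_mult_right by (simp add: ac_simps)
  qed
qed

text \<open>The carry factor is symmetric in \<open>g\<close> and \<open>h\<close> and nonzero, so
  it cancels.\<close>

lemma R_eq: "R_GCA n m \<omega> q g h = \<omega> powi twist_form g h / \<omega> powi twist_form h g"
proof -
  have "(\<Prod>i = 1..m. q i powi ((g i + h i) div int n)) \<noteq> 0"
    using q_nonzero by simp
  then show ?thesis
    unfolding R_GCA_def F_eq by (simp add: add.commute)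
qed

text \<open>The quotient of a bicharacter by its transpose is again a bicharacter, and exchanging
  the arguments inverts it.\<close>

lemma symmetric_Gr_category_R: "symmetric_Gr_category G (R_GCA n m \<omega> q)"
proof -
  interpret comm_group G by (rule comm_group_Zn_power)
  show ?thesis
    by unfold_locales
      (simp_all add: finite_carrier_Zn_power n_pos R_eq root_nonzero root_twist_mult_left root_twist_mult_right)
qed

end

section \<open>Words in the generators\<close>

lemma count_list_replicate: "count_list (replicate k x) y = (if x = y then k else 0)"
  by (induction k) auto

lemma (in assoc_algebra) mult_minus_smult_mult:
  assumes "c \<in> carrier K" and "u \<in> carrier A" and "x \<in> carrier A" and "y \<in> carrier A" and "z \<in> carrier A"
  shows "u \<otimes>\<^bsub>A\<^esub> (x \<ominus>\<^bsub>A\<^esub> c \<odot>\<^bsub>A\<^esub> y) \<otimes>\<^bsub>A\<^esub> z =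
    u \<otimes>\<^bsub>A\<^esub> x \<otimes>\<^bsub>A\<^esub> z \<ominus>\<^bsub>A\<^esub> c \<odot>\<^bsub>A\<^esub> (u \<otimes>\<^bsub>A\<^esub> y \<otimes>\<^bsub>A\<^esub> z)"
  using assms
  by (simp add: a_minus_def A.r_distr A.l_distr A.r_minus A.l_minus smult_mult_left smult_mult_right)

section \<open>Degree and scalar of a word\<close>

context clifford_data
begin

interpretation G: twisting G F by (rule twisting_F)

text \<open>The restriction to \<open>{1..m}\<close> puts the residues of the letter counts into the
  extensional carrier of \<open>G\<close>.\<close>

definition word_degree :: "nat list \<Rightarrow> nat \<Rightarrow> int"
  where "word_degree w = (\<lambda>i\<in>{1..m}. int (count_list w i) mod int n)"

lemma word_degree_closed: "word_degree w \<in> carrier G"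
  using n_pos by (simp add: word_degree_def Zn_power_simps(1))

lemma word_degree_Nil: "word_degree [] = \<one>\<^bsub>G\<^esub>"
  by (simp add: word_degree_def Zn_power_simps(2)[OF n_pos])

lemma word_degree_append: "word_degree (v @ w) = word_degree v \<otimes>\<^bsub>G\<^esub> word_degree w"
  by (auto simp: word_degree_def Zn_power_simps(3)[OF n_pos] fun_eq_iff mod_add_eq)

lemma word_degree_Cons: "word_degree (i # w) = word_degree [i] \<otimes>\<^bsub>G\<^esub> word_degree w"
  using word_degree_append[of "[i]" w] by simp

text \<open>The coefficient picked up when the basis elements of the letters of a word are
  multiplied in the twisted group algebra, bracketed to the right.\<close>

fun word_scalar :: "nat list \<Rightarrow> 'k"
  where "word_scalar [] = 1"
  | "word_scalar (i # w) = word_scalar w * F (word_degree [i]) (word_degree w)"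

text \<open>The cocycle identity makes the bracketing irrelevant. This is the compatibility of
  scalar and twist that makes the push multiplicative.\<close>

lemma word_scalar_append: "word_scalar (v @ w) = word_scalar v * word_scalar w * F (word_degree v) (word_degree w)"
proof (induction v)
  case Nil
  show ?case by (simp add: word_degree_Nil G.twist_one_left word_degree_closed)
next
  case (Cons i v)
  have "F (word_degree [i]) (word_degree v) * F (word_degree (i # v)) (word_degree w) =
      F (word_degree v) (word_degree w) * F (word_degree [i]) (word_degree (v @ w))"
    unfolding word_degree_Cons[of i v] word_degree_append[of v w]
    by (intro G.twist_cocycle word_degree_closed)
  then show ?case by (simp add: Cons mult.left_commute mult.assoc)
qed

lemma word_degree_singleton:
  "word_degree [i] = (\<lambda>j\<in>{1..m}. if j = i then 1 else 0)"
  using n_ge_2 by (auto simp: word_degree_def fun_eq_iff)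

text \<open>Against a unit vector only row \<open>i\<close> of the form survives, and only
  coordinate \<open>i\<close> can carry. The result is one \<open>\<omega>\<close> per smaller
  generator in degree \<open>g\<close>, and a factor \<open>q i\<close> precisely when the exponent
  of \<open>i\<close> wraps around.\<close>

lemma F_word_degree_singleton:
  assumes i: "i \<in> {1..m}" and g: "g \<in> carrier G"
  shows "F (word_degree [i]) g = \<omega> powi (\<Sum>j = 1..<i. g j) * q i powi ((1 + g i) div int n)"
proof -
  have "twist_form (word_degree [i]) g = (\<Sum>l = 1..m. if l = i then (\<Sum>j = 1..<l. g j) else 0)"
    unfolding twist_form_def word_degree_singleton by (intro sum.cong refl) auto
  also have "\<dots> = (\<Sum>j = 1..<i. g j)"
    using i by simp
  finally have form: "twist_form (word_degree [i]) g = (\<Sum>j = 1..<i. g j)" .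
  have "(\<Prod>l = 1..m. q l powi ((word_degree [i] l + g l) div int n)) =
      (\<Prod>l = 1..m. if l = i then q l powi ((1 + g l) div int n) else 1)"
    using carrier_G_range[OF g] by (intro prod.cong refl) (auto simp: word_degree_singleton)
  also have "\<dots> = q i powi ((1 + g i) div int n)"
    using i by simp
  finally show ?thesis unfolding F_eq form by simp
qed

lemma word_degree_nth: "i \<in> {1..m} \<Longrightarrow> word_degree w i = int (count_list w i) mod int n"
  by (simp add: word_degree_def)

text \<open>Prepending a smallest letter crosses no smaller generator, and counts below
  \<open>n\<close> never carry, so each factor of the recursion is 1.\<close>

lemma word_scalar_sorted:
  assumes "sorted w" and "set w \<subseteq> {1..m}" and "\<And>i. count_list w i < n"
  shows "word_scalar w = 1"
  using assms
proof (induction w)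
  case Nil
  show ?case by simp
next
  case (Cons i w)
  have count: "count_list w j < n" for j
    using Cons.prems(3)[of j] by (simp split: if_splits)
  have i: "i \<in> {1..m}" using Cons.prems(2) by simp
  have "(\<Sum>j = 1..<i. word_degree w j) = 0"
  proof (intro sum.neutral ballI)
    fix j assume j: "j \<in> {1..<i}"
    then have "j \<notin> set w" using Cons.prems(1) by auto
    then show "word_degree w j = 0" using i j by (simp add: word_degree_nth count_list_0_iff)
  qed
  moreover have "(1 + word_degree w i) div int n = 0"
    using Cons.prems(3)[of i] i by (simp add: word_degree_nth)
  ultimately have "F (word_degree [i]) (word_degree w) = 1"
    unfolding F_word_degree_singleton[OF i word_degree_closed] by simp
  then show ?case using Cons count by simp
qed

section \<open>Normal words\<close>

definition block :: "(nat \<Rightarrow> int) \<Rightarrow> nat list \<Rightarrow> nat list"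
  where "block g js = concat (map (\<lambda>j. replicate (nat (g j)) j) js)"

definition normal_word :: "(nat \<Rightarrow> int) \<Rightarrow> nat list"
  where "normal_word g = block g [1..<Suc m]"

lemma block_append: "block g (xs @ ys) = block g xs @ block g ys"
  by (simp add: block_def)

lemma set_block: "set (block g js) \<subseteq> set js"
  by (auto simp: block_def)

lemma sorted_block: "sorted js \<Longrightarrow> sorted (block g js)"
proof (induction js)
  case (Cons j js)
  then show ?case using set_block[of g js] by (auto simp: block_def sorted_append)
qed (simp add: block_def)

lemma count_list_block:
  "distinct js \<Longrightarrow> count_list (block g js) i = (if i \<in> set js then nat (g i) else 0)"
  by (induction js) (auto simp: block_def count_list_replicate)

lemma length_block:
  "(\<And>j. j \<in> set js \<Longrightarrow> 0 \<le> g j) \<Longrightarrow> int (length (block g js)) = (\<Sum>j\<leftarrow>js. g j)"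
  by (induction js) (auto simp: block_def)

lemma block_cong: "(\<And>j. j \<in> set js \<Longrightarrow> g j = h j) \<Longrightarrow> block g js = block h js"
  unfolding block_def by (intro arg_cong[where f = concat] map_cong) simp_all

lemma normal_word_in_lists: "normal_word g \<in> lists {1..m}"
  using set_block[of g "[1..<Suc m]"] by (auto simp: normal_word_def)

lemma count_list_normal_word:
  "count_list (normal_word g) i = (if i \<in> {1..m} then nat (g i) else 0)"
  unfolding normal_word_def by (subst count_list_block) auto

lemma word_degree_normal_word:
  assumes g: "g \<in> carrier G"
  shows "word_degree (normal_word g) = g"
proof
  fix i
  show "word_degree (normal_word g) i = g i"
  proof (cases "i \<in> {1..m}")
    case True
    with carrier_G_range[OF g True] show ?thesis
      by (simp add: word_degree_nth count_list_normal_word)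
  next
    case False
    \<comment> \<open>Elements of the group are extensional, so both functions have this default
      value outside \<open>{1..m}\<close>.\<close>
    have "g i = undefined"
      using g False unfolding Zn_power_simps(1)[OF n_pos] by (rule PiE_arb)
    then show ?thesis
      by (simp only: word_degree_def restrict_apply False if_False)
  qed
qed

lemma word_scalar_normal_word:
  assumes g: "g \<in> carrier G"
  shows "word_scalar (normal_word g) = 1"
proof (rule word_scalar_sorted)
  show "sorted (normal_word g)"
    unfolding normal_word_def by (rule sorted_block) (simp del: upt_Suc)
  show "count_list (normal_word g) i < n" for i
    using carrier_G_range[OF g, of i] n_pos by (auto simp: count_list_normal_word)
  show "set (normal_word g) \<subseteq> {1..m}"
    using normal_word_in_lists by auto
qed

lemma normal_word_Nil: "normal_word \<one>\<^bsub>G\<^esub> = []"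
proof -
  have "normal_word \<one>\<^bsub>G\<^esub> = block (\<lambda>_. 0) [1..<Suc m]"
    unfolding normal_word_def
    by (rule block_cong) (auto simp: Zn_power_simps(2)[OF n_pos] simp del: upt_Suc)
  then show ?thesis by (simp add: block_def del: upt_Suc)
qed

text \<open>The cut at \<open>i\<close> separates the smaller generators, which a new letter
  \<open>i\<close> has to cross, from the larger ones, which it never meets.\<close>

lemma normal_word_split:
  assumes "i \<in> {1..m}"
  shows "normal_word g = block g [1..<i] @ replicate (nat (g i)) i @ block g [Suc i..<Suc m]"
proof -
  have "[1..<Suc m] = [1..<i] @ i # [Suc i..<Suc m]"
    using assms upt_add_eq_append[of 1 i "Suc m - i"] upt_conv_Cons[of i "Suc m"]
    by (simp del: upt_Suc)
  then have "normal_word g = block g ([1..<i] @ [i] @ [Suc i..<Suc m])"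
    by (simp add: normal_word_def del: upt_Suc)
  then show ?thesis by (simp only: block_append) (simp add: block_def)
qed

text \<open>Otherwise \<open>{1..m}\<close> and \<open>[1..<Suc m]\<close> would be rewritten inside the algebra and the normal words.\<close>

declare One_nat_def [simp del] upt_Suc [simp del]

section \<open>The free algebra and the Clifford relations\<close>

abbreviation "words \<equiv> \<lparr>carrier = lists {1..m}, monoid.mult = (@), one = []\<rparr>"

interpretation W: twisting words "\<lambda>_ _. 1 :: 'k"
  by (rule twisting_free_monoid)

interpretation A: assoc_algebra class_ring W.T
  by (rule W.assoc_algebra_twisted_algebra)

lemma free_algebra_eq: "free_algebra {1..m} = W.T"
  by (simp add: free_algebra_def)

lemma word_mult:
  "(basis_elt v :: nat list \<Rightarrow> 'k) \<otimes>\<^bsub>W.T\<^esub> basis_elt w = basis_elt (v @ w)"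
  by (subst basis_elt_mult) simp

lemma word_closed: "w \<in> lists {1..m} \<Longrightarrow> basis_elt w \<in> carrier W.T"
  by (rule W.basis_elt_closed) simp

lemma word_pow:
  "(basis_elt [i] :: nat list \<Rightarrow> 'k) [^]\<^bsub>W.T\<^esub> k = basis_elt (replicate k i)"
proof (induction k)
  case 0
  show ?case by (simp add: nat_pow_def)
next
  case (Suc k)
  then show ?case
    by (simp only: monoid.nat_pow_Suc[OF W.monoid_twisted_algebra] word_mult
        replicate_append_same replicate_Suc)
qed

lemma word_minus:
  assumes "v \<in> lists {1..m}" and "w \<in> lists {1..m}"
  shows "basis_elt v \<ominus>\<^bsub>W.T\<^esub> c \<odot>\<^bsub>W.T\<^esub> basis_elt w = (\<lambda>x. basis_elt v x - c * basis_elt w x)"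
  unfolding W.twisted_algebra_minus[OF word_closed[OF assms(1)] W.twisted_algebra_smult_closed[OF word_closed[OF assms(2)]]]
  by (simp only: twisted_monoid_algebra_simps(5))

abbreviation "relations \<equiv> clifford_relations n m \<omega> q"

text \<open>Each relation is a word minus a multiple of another word, the form that
  \<open>push_binomial\<close> evaluates and \<open>reduces\<close> turns into a rewriting
  rule.\<close>

lemma relations_eq:
  "relations =
    {(\<lambda>x. basis_elt (replicate n i) x - q i * basis_elt [] x) | i. i \<in> {1..m}} \<union>
    {(\<lambda>x. basis_elt [i, j] x - \<omega> * basis_elt [j, i] x) | i j. i \<in> {1..m} \<and> j \<in> {1..m} \<and> i > j}"
proof -
  have power: "basis_elt [i] [^]\<^bsub>W.T\<^esub> n \<ominus>\<^bsub>W.T\<^esub> q i \<odot>\<^bsub>W.T\<^esub> \<one>\<^bsub>W.T\<^esub> =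
      (\<lambda>x. basis_elt (replicate n i) x - q i * basis_elt [] x)" if "i \<in> {1..m}" for i
    unfolding word_pow twisted_monoid_algebra_simps(2) monoid.simps
    using that by (intro word_minus) auto
  have commutation: "basis_elt [i] \<otimes>\<^bsub>W.T\<^esub> basis_elt [j] \<ominus>\<^bsub>W.T\<^esub> \<omega> \<odot>\<^bsub>W.T\<^esub> (basis_elt [j] \<otimes>\<^bsub>W.T\<^esub> basis_elt [i]) =
      (\<lambda>x. basis_elt [i, j] x - \<omega> * basis_elt [j, i] x)" if "i \<in> {1..m}" "j \<in> {1..m}" for i j
    unfolding word_mult append.simps using that by (intro word_minus) auto
  show ?thesis
    unfolding clifford_relations_def Let_def free_algebra_eq
    by (intro arg_cong2[where f = "(\<union>)"] Collect_cong ex_cong1 rev_conj_cong refl)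
      (simp_all only: power commutation)
qed

lemma binomial_closed:
  assumes "v \<in> lists {1..m}" and "w \<in> lists {1..m}"
  shows "(\<lambda>x. basis_elt v x - c * basis_elt w x) \<in> carrier W.T"
  unfolding word_minus[OF assms, symmetric]
  by (intro A.minus_closed W.twisted_algebra_smult_closed word_closed assms)

lemma relations_closed: "relations \<subseteq> carrier W.T"
  unfolding relations_eq by (auto intro!: binomial_closed simp del: twisted_monoid_algebra_simps)

lemma push_binomial:
  "push s d (\<lambda>x. basis_elt v x - c * basis_elt w x) =
    (\<lambda>g. s v * basis_elt (d v) g - c * s w * basis_elt (d w) g)"
proof -
  have "finite {x. - c * basis_elt w x \<noteq> 0}"
    by (cases "c = 0") simp_all
  then have "push s d (\<lambda>x. basis_elt v x + (- c) * basis_elt w x) =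
      (\<lambda>g. s v * basis_elt (d v) g + (- c) * (s w * basis_elt (d w) g))"
    by (simp add: push_add push_cmult push_basis_elt del: mult_minus_left)
  then show ?thesis by (simp add: mult.assoc)
qed

section \<open>Rewriting modulo the relations\<close>

abbreviation "relation_ideal \<equiv> Idl\<^bsub>W.T\<^esub> relations"

interpretation I: ideal relation_ideal W.T
  using W.ring_twisted_algebra relations_closed by (rule ring.genideal_ideal)

text \<open>\<open>v\<close> equals \<open>c w\<close> modulo the relations.\<close>

definition reduces :: "'k \<Rightarrow> nat list \<Rightarrow> nat list \<Rightarrow> bool"
  where "reduces c v w \<longleftrightarrow> v \<in> lists {1..m} \<and> w \<in> lists {1..m} \<and>
    (\<lambda>x. basis_elt v x - c * basis_elt w x) \<in> relation_ideal"

lemma reduces_refl: "v \<in> lists {1..m} \<Longrightarrow> reduces 1 v v"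
  using I.zero_closed by (simp add: reduces_def)

text \<open>Scalars multiply because \<open>u - c e w\<close> is the sum of \<open>u - c v\<close>
  and \<open>c\<close> times \<open>v - e w\<close>.\<close>

lemma reduces_trans:
  assumes "reduces c u v" and "reduces e v w"
  shows "reduces (c * e) u w"
proof -
  have "(\<lambda>x. basis_elt u x - c * basis_elt v x) \<oplus>\<^bsub>W.T\<^esub>
      c \<odot>\<^bsub>W.T\<^esub> (\<lambda>x. basis_elt v x - e * basis_elt w x) \<in> relation_ideal"
    using assms by (intro I.a_closed A.ideal_smult_closed I.ideal_axioms) (simp_all add: reduces_def)
  then show ?thesis
    using assms by (simp add: reduces_def algebra_simps)
qed

text \<open>Here two-sidedness of the ideal enters: the binomial is multiplied by \<open>u\<close>
  on the left and by \<open>z\<close> on the right.\<close>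

lemma reduces_context:
  assumes vw: "reduces c v w" and u: "u \<in> lists {1..m}" and z: "z \<in> lists {1..m}"
  shows "reduces c (u @ v @ z) (u @ w @ z)"
proof -
  have v: "v \<in> lists {1..m}" and w: "w \<in> lists {1..m}" using vw by (simp_all add: reduces_def)
  note closed = word_closed[OF u] word_closed[OF v] word_closed[OF w] word_closed[OF z]
  let ?b = "\<lambda>v. basis_elt v :: nat list \<Rightarrow> 'k"
  have "?b u \<otimes>\<^bsub>W.T\<^esub> (?b v \<ominus>\<^bsub>W.T\<^esub> c \<odot>\<^bsub>W.T\<^esub> ?b w) \<otimes>\<^bsub>W.T\<^esub> ?b z \<in> relation_ideal"
    using vw closed unfolding word_minus[OF v w]
    by (intro I.I_l_closed I.I_r_closed) (simp_all only: reduces_def)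
  also have "?b u \<otimes>\<^bsub>W.T\<^esub> (?b v \<ominus>\<^bsub>W.T\<^esub> c \<odot>\<^bsub>W.T\<^esub> ?b w) \<otimes>\<^bsub>W.T\<^esub> ?b z =
      ?b u \<otimes>\<^bsub>W.T\<^esub> ?b v \<otimes>\<^bsub>W.T\<^esub> ?b z \<ominus>\<^bsub>W.T\<^esub> c \<odot>\<^bsub>W.T\<^esub> (?b u \<otimes>\<^bsub>W.T\<^esub> ?b w \<otimes>\<^bsub>W.T\<^esub> ?b z)"
    using closed by (intro A.mult_minus_smult_mult) simp_all
  finally show ?thesis
    using u v w z unfolding reduces_def word_mult
    by (subst (asm) word_minus) (simp_all only: append_in_lists_conv append_assoc)
qed

lemma reduces_commute:
  assumes "i \<in> {1..m}" and "j \<in> {1..m}" and "j < i"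
  shows "reduces \<omega> [i, j] [j, i]"
proof -
  have "(\<lambda>x. basis_elt [i, j] x - \<omega> * basis_elt [j, i] x) \<in> relations"
    unfolding relations_eq using assms by blast
  then show ?thesis
    using assms ring.genideal_self[OF W.ring_twisted_algebra relations_closed]
    by (auto simp: reduces_def)
qed

lemma reduces_power:
  assumes "i \<in> {1..m}"
  shows "reduces (q i) (replicate n i) []"
proof -
  have "(\<lambda>x. basis_elt (replicate n i) x - q i * basis_elt [] x) \<in> relations"
    unfolding relations_eq using assms by blast
  then show ?thesis
    using assms ring.genideal_self[OF W.ring_twisted_algebra relations_closed]
    by (auto simp: reduces_def)
qed

text \<open>Every letter of \<open>v\<close> is smaller than \<open>i\<close>, so each of the
  \<open>length v\<close> transpositions costs one factor \<open>\<omega>\<close>.\<close>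

lemma reduces_move:
  assumes i: "i \<in> {1..m}" and "v \<in> lists {1..<i}"
  shows "reduces (\<omega> ^ length v) (i # v) (v @ [i])"
  using assms(2)
proof (induction v)
  case Nil
  show ?case using reduces_refl[of "[i]"] i by simp
next
  case (Cons j v)
  then have j: "j \<in> {1..m}" "j < i" and v: "v \<in> lists {1..m}" using i by auto
  have "reduces \<omega> ([] @ [i, j] @ v) ([] @ [j, i] @ v)"
    using v by (intro reduces_context reduces_commute i j) simp_all
  moreover have "reduces (\<omega> ^ length v) ([j] @ (i # v) @ []) ([j] @ (v @ [i]) @ [])"
    using j Cons by (intro reduces_context) simp_all
  ultimately show ?case using reduces_trans by fastforce
qed

text \<open>The heart of the rewriting: the new letter crosses the smaller generators and then joins
  its own block, and the two costs multiply to the value in \<open>F_word_degree_singleton\<close>,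
  because the length of the crossed part is the sum of the exponents below \<open>i\<close>.\<close>

lemma reduces_Cons_normal_word:
  assumes i: "i \<in> {1..m}" and g: "g \<in> carrier G"
  shows "reduces (F (word_degree [i]) g) (i # normal_word g) (normal_word (word_degree [i] \<otimes>\<^bsub>G\<^esub> g))"
proof -
  let ?h = "word_degree [i] \<otimes>\<^bsub>G\<^esub> g"
  define v where "v = block g [1..<i]"
  define z where "z = block g [Suc i..<Suc m]"
  have v: "v \<in> lists {1..<i}"
    using set_block[of g "[1..<i]"] unfolding v_def by auto
  then have v': "v \<in> lists {1..m}" using i by auto
  have z: "z \<in> lists {1..m}"
    using set_block[of g "[Suc i..<Suc m]"] i unfolding z_def by auto
  have range: "0 \<le> g j \<and> g j < int n" if "j \<in> {1..m}" for j
    using carrier_G_range[OF g that] .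
  have h: "?h j = (if j = i then (1 + g i) mod int n else g j)" if "j \<in> {1..m}" for j
    using that range[OF that] by (simp add: Zn_power_simps(3)[OF n_pos] word_degree_singleton)
  have block_h: "block ?h [1..<i] = v" "block ?h [Suc i..<Suc m] = z"
    unfolding v_def z_def using i h by (auto intro!: block_cong simp del: upt_Suc)
  have normal_h: "normal_word ?h = v @ replicate (nat ((1 + g i) mod int n)) i @ z"
    using normal_word_split[OF i, of ?h] h[OF i] by (simp add: block_h)
  have "int (length v) = (\<Sum>j\<leftarrow>[1..<i]. g j)"
    unfolding v_def using range i by (intro length_block) auto
  then have length_v: "int (length v) = (\<Sum>j = 1..<i. g j)"
    by (simp add: sum_list_distinct_conv_sum_set)
  have "reduces (\<omega> ^ length v) ([] @ (i # v) @ (replicate (nat (g i)) i @ z))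
      ([] @ (v @ [i]) @ (replicate (nat (g i)) i @ z))"
    using z i by (intro reduces_context reduces_move v) auto
  then have move: "reduces (\<omega> ^ length v) (i # normal_word g) (v @ replicate (Suc (nat (g i))) i @ z)"
    by (simp add: normal_word_split[OF i] v_def z_def)
  \<comment> \<open>The block of \<open>i\<close> now has \<open>g i + 1\<close> letters, at most
    \<open>n\<close>. If it has \<open>n\<close>, the power relation deletes it and the exponent of
    \<open>q i\<close> is 1; otherwise the word is already normal and the exponent is 0.\<close>
  have carry: "reduces (q i powi ((1 + g i) div int n)) (v @ replicate (Suc (nat (g i))) i @ z)
      (normal_word ?h)"
  proof (cases "1 + g i = int n")
    case True
    then have "Suc (nat (g i)) = n" using range[OF i] by linarith
    then show ?thesis
      using reduces_context[OF reduces_power[OF i] v' z] True n_pos by (simp add: normal_h)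
  next
    case False
    then have "(1 + g i) div int n = 0" "nat ((1 + g i) mod int n) = Suc (nat (g i))"
      using range[OF i] by auto
    then show ?thesis
      unfolding normal_h using v' z i by (simp, intro reduces_refl) auto
  qed
  have "F (word_degree [i]) g = \<omega> ^ length v * q i powi ((1 + g i) div int n)"
    unfolding F_word_degree_singleton[OF i g] length_v[symmetric] by simp
  then show ?thesis using reduces_trans[OF move carry] by simp
qed

text \<open>Reducing the tail first leaves one letter in front of a normal word; its cost is the
  factor by which \<open>word_scalar\<close> grows in the recursion.\<close>

lemma reduces_normal_word:
  assumes "w \<in> lists {1..m}"
  shows "reduces (word_scalar w) w (normal_word (word_degree w))"
  using assms
proof (induction w)
  case Nil
  show ?case using reduces_refl[of "[]"] by (simp add: word_degree_Nil normal_word_Nil)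
next
  case (Cons i w)
  have "reduces (word_scalar w) ([i] @ w @ []) ([i] @ normal_word (word_degree w) @ [])"
    using Cons by (intro reduces_context) simp_all
  moreover have "reduces (F (word_degree [i]) (word_degree w)) (i # normal_word (word_degree w)) (normal_word (word_degree (i # w)))"
    unfolding word_degree_Cons[of i w] using Cons by (intro reduces_Cons_normal_word word_degree_closed) simp
  ultimately show ?case using reduces_trans by fastforce
qed

text \<open>The two words of each relation have the same degree, so only their scalars have to be
  compared.\<close>

lemma relations_kernel:
  assumes "a \<in> relations"
  shows "push word_scalar word_degree a = (\<lambda>_. 0)"
proof -
  from assms consider
      i where "i \<in> {1..m}" "a = (\<lambda>x. basis_elt (replicate n i) x - q i * basis_elt [] x)"
    | i j where "i \<in> {1..m}" "j \<in> {1..m}" "j < i" "a = (\<lambda>x. basis_elt [i, j] x - \<omega> * basis_elt [j, i] x)"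
    unfolding relations_eq by blast
  then show ?thesis
  proof cases
    case 1
    \<comment> \<open>The last \<open>n - 1\<close> letters still form a sorted word of scalar 1;
      the one remaining letter raises the exponent to \<open>n\<close>, and this single carry
      produces \<open>q i\<close>.\<close>
    let ?w = "replicate (n - 1) i"
    have n: "replicate n i = i # ?w" using n_pos by (cases n) simp_all
    have "word_scalar ?w = 1"
      using 1(1) n_pos by (intro word_scalar_sorted) (auto simp: count_list_replicate)
    moreover have "(\<Sum>j = 1..<i. word_degree ?w j) = 0"
      using 1(1) by (intro sum.neutral) (auto simp: word_degree_nth count_list_replicate)
    moreover have "word_degree ?w i = int (n - 1)"
      unfolding word_degree_nth[OF 1(1)] count_list_replicate if_P[OF refl]
      using n_pos by (intro mod_pos_pos_trivial) simp_all
    then have "1 + word_degree ?w i = int n" using n_pos by simp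
    ultimately have "word_scalar (replicate n i) = q i"
      unfolding n word_scalar.simps(2) F_word_degree_singleton[OF 1(1) word_degree_closed] using n_pos by simp
    moreover have "word_degree (replicate n i) = word_degree []"
      unfolding word_degree_def by (rule restrict_ext) (simp add: count_list_replicate)
    ultimately show ?thesis unfolding 1(2) push_binomial by simp
  next
    case 2
    \<comment> \<open>In increasing order with distinct letters, every count is at most 1, below
      \<open>n\<close> because \<open>n \<ge> 2\<close>.\<close>
    have "word_scalar [j, i] = 1"
      using 2 n_ge_2 by (intro word_scalar_sorted) auto
    moreover have "(\<Sum>l = 1..<i. word_degree [j] l) = (\<Sum>l = 1..<i. if l = j then 1 else 0)"
      using 2 by (intro sum.cong) (auto simp: word_degree_singleton)
    then have "F (word_degree [i]) (word_degree [j]) = \<omega>"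
      using 2 n_ge_2 unfolding F_word_degree_singleton[OF 2(1) word_degree_closed] by (simp add: word_degree_singleton)
    then have "word_scalar [i, j] = \<omega>"
      by (simp add: word_degree_Nil G.twist_one_right word_degree_closed)
    moreover have "word_degree [i, j] = word_degree [j, i]"
      unfolding word_degree_def by (rule restrict_ext) simp
    ultimately show ?thesis unfolding 2(4) push_binomial by simp
  qed
qed

lemma presentation:
  "presentation words (\<lambda>_ _. 1) G F word_degree word_scalar normal_word relations"
proof (intro presentation.intro W.twisting_axioms G.twisting_axioms presentation_axioms.intro)
  fix w assume "w \<in> carrier words"
  then have w: "w \<in> lists {1..m}" by simp
  show "(\<lambda>x. basis_elt w x - word_scalar w * basis_elt (normal_word (word_degree w)) x) \<in> relation_ideal"
    using reduces_normal_word[OF w] by (simp only: reduces_def)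
qed (simp_all only: word_degree_closed word_degree_Nil word_degree_append word_degree_normal_word word_scalar.simps word_scalar_append
    word_scalar_normal_word normal_word_in_lists relations_closed relations_kernel mult_1_left
    monoid.simps partial_object.simps)

end

theorem proposition3p1:
  fixes n m :: nat and \<omega> :: "'k::field" and q :: "nat \<Rightarrow> 'k"
  defines "G \<equiv> Zn_power n m"
    and "T \<equiv> twisted_monoid_algebra (Zn_power n m) (F_GCA n m \<omega> q)"
    and "C \<equiv> gen_clifford_algebra n m \<omega> q"
  assumes "n \<ge> 2" and "\<not> CHAR('k) dvd n" and "primitive_root_of_unity n \<omega>"
    and "m \<ge> 1" and "\<And>i. i \<in> {1..m} \<Longrightarrow> q i \<noteq> 0"
  shows "\<exists>\<phi>. algebra_iso T C \<phi> \<and>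
           algebra_in_symmetric_Gr_category G (R_GCA n m \<omega> q) C
             (\<lambda>g. {\<phi> (c \<odot>\<^bsub>T\<^esub> basis_elt g) | c. True})"
proof -
  interpret clifford_data n m \<omega> q
    using assms(4,6,8) by unfold_locales (simp_all add: primitive_root_of_unity_def)
  have "C = quotient_algebra (free_algebra {1..m}) (Idl\<^bsub>free_algebra {1..m}\<^esub> relations)"
    unfolding C_def gen_clifford_algebra_def ..
  then have "\<exists>\<phi>. algebra_iso T C \<phi>"
    using presentation.algebra_iso_presentation[OF presentation] unfolding T_def free_algebra_eq by metis
  then obtain \<phi> where iso: "algebra_iso T C \<phi>" ..
  then show ?thesis
    using algebra_in_symmetric_Gr_category_iso[OF twisting_F symmetric_Gr_category_R, of C \<phi>]
    unfolding T_def G_def by blast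
qed

end
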